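(* Let $\mathsf{V}=(\mathsf{V},\otimes,k)$ be a commutative quantale, let $X,Y,Z$ be complete $\mathsf{V}$-categories, and let $(X,Y,Z,\circledast,\swarrow,\searrow)$ be a two-variable adjunction in $\mathsf{V}\text{-}\mathbf{Cat}$. Let $A,B$ be $\mathsf{V}$-categories and let $\phi\colon A^{\mathrm{op}}\otimes B\to Z$ be a $\mathsf{V}$-bifunctor. Then a $\mathsf{V}$-category $C$ is equivalent to $\mathsf{M}\phi$ if, and only if, $C$ is complete and there exist a dense $\mathsf{V}$-bifunctor $\alpha\colon A\otimes Y\to C$ and a codense $\mathsf{V}$-bifunctor $\beta\colon B\otimes X^{\mathrm{op}}\to C$ such that $$C(\alpha(a,y),\beta(b,x))=Z(x\circledast y,\phi(a,b))$$ for all $a\in A$, $b\in B$, $x\in X$, $y\in Y$.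
   Context: A commutative quantale is a commutative monoid $(\mathsf{V},\otimes,k)$ whose underlying set is a complete lattice with $x\otimes\bigvee_i y_i=\bigvee_i x\otimes y_i$; the implication $\to$ is defined by $x\otimes y\leq z\iff x\leq y\to z$. A $\mathsf{V}$-category is a set $X$ with a map $X(-,-)\colon X\times X\to\mathsf{V}$ such that $k\leq X(x,x)$ and $X(x,y)\otimes X(y,z)\leq X(x,z)$. Its underlying preorder is $x\leq y\iff k\leq X(x,y)$; $x\cong y$ means $x\leq y$ and $y\leq x$. A $\mathsf{V}$-functor $f\colon X\to Y$ is a map with $X(x,y)\leq Y(fx,fy)$; $\mathsf{V}$-functors are ordered pointwise ($f\leq g$ iff $fx\leq gx$ for all $x$). Two $\mathsf{V}$-categories $X,Y$ are equivalent if there are $\mathsf{V}$-functors $f\colon X\to Y$, $g\colon Y\to X$ with $gf\cong 1_X$ and $fg\cong 1_Y$. $\mathsf{V}$ is a $\mathsf{V}$-category via $\mathsf{V}(x,y)=x\to y$. $X^{\mathrm{op}}$ has the same objects with $X^{\mathrm{op}}(x,y)=X(y,x)$. $X\otimes Y$ has object set $X\times Y$ and $(X\otimes Y)((x,y),(x',y'))=X(x,x')\otimes Y(y,y')$. $Y^X$ is the $\mathsf{V}$-category of $\mathsf{V}$-functors $X\to Y$ with $Y^X(f,g)=\bigwedge_{x\in X}Y(fx,gx)$. A $\mathsf{V}$-bifunctor is a $\mathsf{V}$-functor $X\otimes Y\to Z$. A two-variable adjunction $(X,Y,Z,\circledast,\swarrow,\searrow)$ in $\mathsf{V}\text{-}\mathbf{Cat}$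 consists of $\mathsf{V}$-bifunctors $\circledast\colon X\otimes Y\to Z$, $\swarrow\colon Z\otimes Y^{\mathrm{op}}\to X$, $\searrow\colon X^{\mathrm{op}}\otimes Z\to Y$ such that $Z(x\circledast y,z)=X(x,z\swarrow y)=Y(y,x\searrow z)$ for all $x\in X$, $y\in Y$, $z\in Z$. A supremum of $\mu\in\mathsf{V}^{X^{\mathrm{op}}}$ is an object $\sup\mu\in X$ with $X(\sup\mu,x)=\bigwedge_{y\in X}\mu y\to X(y,x)$ for all $x\in X$; an infimum of $\lambda\in\mathsf{V}^X$ is an object $\inf\lambda\in X$ with $X(x,\inf\lambda)=\bigwedge_{y\in X}\lambda y\to X(x,y)$ for all $x\in X$. $X$ is complete if every $\lambda\in\mathsf{V}^X$ has an infimum; equivalently every $\mu\in\mathsf{V}^{X^{\mathrm{op}}}$ has a supremum. In a complete $\mathsf{V}$-category all joins and meets exist in the underlying preorder (determined up to $\cong$; $\bigvee,\bigwedge$ denote chosen ones), and $X(x,\bigwedge_i y_i)=\bigwedge_i X(x,y_i)$, $X(\bigvee_i y_i,x)=\bigwedge_i X(y_i,x)$. A $\mathsf{V}$-functor $f\colon X\to Y$ is dense if for every $y\in Y$ there is $\mu\in\mathsf{V}^{X^{\mathrm{op}}}$ such that $y$ is a supremum of the presheaf $y'\mapsto\bigvee_{x\in X}Y(y',fx)\otimes\mu x$ on $Y$; it is codense if for every $y\in Y$ there is $\lambda\in\mathsf{V}^X$ such that $y$ is an infimum of the copresheaf $y'\mapsto\bigvee_{x\in X}Y(fx,y')\otimes\lambda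 x$ on $Y$. For $\phi\colon A^{\mathrm{op}}\otimes B\to Z$ define $\mathsf{V}$-functors $$\phi_{\uparrow}\colon Y^{A^{\mathrm{op}}}\to(X^B)^{\mathrm{op}},\ (\phi_{\uparrow}\mu)b=\bigwedge_{a\in A}\phi(a,b)\swarrow\mu a,\qquad \phi^{\downarrow}\colon(X^B)^{\mathrm{op}}\to Y^{A^{\mathrm{op}}},\ (\phi^{\downarrow}\lambda)a=\bigwedge_{b\in B}\lambda b\searrow\phi(a,b),$$ with meets taken in the underlying preorders of $X$ and $Y$. Then $\mathsf{M}\phi:=\{\mu\in Y^{A^{\mathrm{op}}}\mid\phi^{\downarrow}\phi_{\uparrow}\mu\cong\mu\}$, a $\mathsf{V}$-category with the hom inherited from $Y^{A^{\mathrm{op}}}$. *)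

theory Defs
  imports Main "HOL-Library.FuncSet"
begin

text \<open>The tensor product is \<open>*\<close> and its unit \<open>k\<close> is \<open>1\<close>. Since the family
  \<open>(y\<^sub>i)\<close> may be empty, \<open>mult_Sup\<close> includes \<open>x * bot = bot\<close>.\<close>

class comm_quantale = complete_lattice + comm_monoid_mult +
  assumes mult_Sup: "x * Sup S = (SUP y\<in>S. x * y)"

definition qimp :: "'v::comm_quantale \<Rightarrow> 'v \<Rightarrow> 'v" (infixr "\<rightarrow>\<^sub>q" 65) where
  "y \<rightarrow>\<^sub>q z = Sup {x. x * y \<le> z}"

lemma mult_mono_q:
  fixes x :: "'v::comm_quantale"
  assumes "y \<le> z"
  shows "x * y \<le> x * z"
proof -
  have "x * z = x * Sup {y, z}" using assms by (simp add: sup_absorb2)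
  also have "\<dots> = (SUP u\<in>{y, z}. x * u)" by (rule mult_Sup)
  finally have "x * z = sup (x * y) (x * z)" by simp
  then show ?thesis by (metis sup_ge1)
qed

lemma qimp_adjoint:
  fixes x :: "'v::comm_quantale"
  shows "x * y \<le> z \<longleftrightarrow> x \<le> (y \<rightarrow>\<^sub>q z)"
proof
  assume "x * y \<le> z"
  then show "x \<le> (y \<rightarrow>\<^sub>q z)" unfolding qimp_def by (auto intro: Sup_upper)
next
  assume "x \<le> (y \<rightarrow>\<^sub>q z)"
  then have "y * x \<le> y * (y \<rightarrow>\<^sub>q z)" by (rule mult_mono_q)
  also have "\<dots> = (SUP u\<in>{u. u * y \<le> z}. y * u)" unfolding qimp_def by (rule mult_Sup)
  also have "\<dots> \<le> z" by (auto intro!: SUP_least simp: mult.commute)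
  finally show "x * y \<le> z" by (simp add: mult.commute)
qed

text \<open>Object sets are explicit carriers, so that empty \<open>V\<close>-categories are included; the values
  of \<open>Hom\<close> outside the carrier are irrelevant.\<close>

record ('a, 'v) vcat =
  Obj :: "'a set"
  Hom :: "'a \<Rightarrow> 'a \<Rightarrow> 'v"

definition vcategory :: "('a, 'v::comm_quantale) vcat \<Rightarrow> bool" where
  "vcategory X \<longleftrightarrow>
     (\<forall>x\<in>Obj X. 1 \<le> Hom X x x) \<and>
     (\<forall>x\<in>Obj X. \<forall>y\<in>Obj X. \<forall>z\<in>Obj X. Hom X x y * Hom X y z \<le> Hom X x z)"

definition vle :: "('a, 'v::comm_quantale) vcat \<Rightarrow> 'a \<Rightarrow> 'a \<Rightarrow> bool" where
  "vle X x y \<longleftrightarrow> 1 \<le> Hom X x y"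

definition viso :: "('a, 'v::comm_quantale) vcat \<Rightarrow> 'a \<Rightarrow> 'a \<Rightarrow> bool" where
  "viso X x y \<longleftrightarrow> vle X x y \<and> vle X y x"

definition vfunctor ::
  "('a, 'v::comm_quantale) vcat \<Rightarrow> ('b, 'v) vcat \<Rightarrow> ('a \<Rightarrow> 'b) \<Rightarrow> bool" where
  "vfunctor X Y f \<longleftrightarrow>
     f \<in> Obj X \<rightarrow> Obj Y \<and>
     (\<forall>x\<in>Obj X. \<forall>y\<in>Obj X. Hom X x y \<le> Hom Y (f x) (f y))"

definition vequivalent ::
  "('a, 'v::comm_quantale) vcat \<Rightarrow> ('b, 'v) vcat \<Rightarrow> bool" where
  "vequivalent X Y \<longleftrightarrow>
     (\<exists>f g. vfunctor X Y f \<and> vfunctor Y X g \<and>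
        (\<forall>x\<in>Obj X. viso X (g (f x)) x) \<and>
        (\<forall>y\<in>Obj Y. viso Y (f (g y)) y))"

definition vbase :: "('v::comm_quantale, 'v) vcat" where
  "vbase = \<lparr>Obj = UNIV, Hom = (\<lambda>x y. x \<rightarrow>\<^sub>q y)\<rparr>"

definition vop :: "('a, 'v::comm_quantale) vcat \<Rightarrow> ('a, 'v) vcat" where
  "vop X = \<lparr>Obj = Obj X, Hom = (\<lambda>x y. Hom X y x)\<rparr>"

definition vtensor ::
  "('a, 'v::comm_quantale) vcat \<Rightarrow> ('b, 'v) vcat \<Rightarrow> ('a \<times> 'b, 'v) vcat"
  (infixr "\<otimes>\<^sub>V" 75) where
  "X \<otimes>\<^sub>V Y = \<lparr>Obj = Obj X \<times> Obj Y,
     Hom = (\<lambda>(x, y) (x', y'). Hom X x x' * Hom Y y y')\<rparr>"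

text \<open>\<open>vexp Y X\<close> is \<open>Y\<^sup>X\<close>. Its objects are the functors that are \<open>undefined\<close> outside \<open>Obj X\<close>,
  so that each functor between the carriers is represented exactly once.\<close>

definition vexp ::
  "('b, 'v::comm_quantale) vcat \<Rightarrow> ('a, 'v) vcat \<Rightarrow> ('a \<Rightarrow> 'b, 'v) vcat" where
  "vexp Y X = \<lparr>Obj = {f \<in> Obj X \<rightarrow>\<^sub>E Obj Y. vfunctor X Y f},
     Hom = (\<lambda>f g. INF x\<in>Obj X. Hom Y (f x) (g x))\<rparr>"

definition two_var_adjunction ::
  "('x, 'v::comm_quantale) vcat \<Rightarrow> ('y, 'v) vcat \<Rightarrow> ('z, 'v) vcat \<Rightarrow>
   ('x \<times> 'y \<Rightarrow> 'z) \<Rightarrow> ('z \<times> 'y \<Rightarrow> 'x) \<Rightarrow> ('x \<times> 'z \<Rightarrow> 'y) \<Rightarrow> bool" where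
  "two_var_adjunction X Y Z ten limp rimp \<longleftrightarrow>
     vfunctor (X \<otimes>\<^sub>V Y) Z ten \<and>
     vfunctor (Z \<otimes>\<^sub>V vop Y) X limp \<and>
     vfunctor (vop X \<otimes>\<^sub>V Z) Y rimp \<and>
     (\<forall>x\<in>Obj X. \<forall>y\<in>Obj Y. \<forall>z\<in>Obj Z.
        Hom Z (ten (x, y)) z = Hom X x (limp (z, y)) \<and>
        Hom X x (limp (z, y)) = Hom Y y (rimp (x, z)))"

definition is_vsup :: "('a, 'v::comm_quantale) vcat \<Rightarrow> ('a \<Rightarrow> 'v) \<Rightarrow> 'a \<Rightarrow> bool" where
  "is_vsup X \<mu> s \<longleftrightarrow> s \<in> Obj X \<and>
     (\<forall>x\<in>Obj X. Hom X s x = (INF y\<in>Obj X. \<mu> y \<rightarrow>\<^sub>q Hom X y x))"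

definition is_vinf :: "('a, 'v::comm_quantale) vcat \<Rightarrow> ('a \<Rightarrow> 'v) \<Rightarrow> 'a \<Rightarrow> bool" where
  "is_vinf X \<nu> i \<longleftrightarrow> i \<in> Obj X \<and>
     (\<forall>x\<in>Obj X. Hom X x i = (INF y\<in>Obj X. \<nu> y \<rightarrow>\<^sub>q Hom X x y))"

definition vcomplete :: "('a, 'v::comm_quantale) vcat \<Rightarrow> bool" where
  "vcomplete X \<longleftrightarrow> (\<forall>\<nu>\<in>Obj (vexp vbase X). \<exists>i. is_vinf X \<nu> i)"

definition vdense ::
  "('a, 'v::comm_quantale) vcat \<Rightarrow> ('b, 'v) vcat \<Rightarrow> ('a \<Rightarrow> 'b) \<Rightarrow> bool" where
  "vdense X Y f \<longleftrightarrow>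
     (\<forall>y\<in>Obj Y. \<exists>\<mu>\<in>Obj (vexp vbase (vop X)).
        is_vsup Y (\<lambda>y'. SUP x\<in>Obj X. Hom Y y' (f x) * \<mu> x) y)"

definition vcodense ::
  "('a, 'v::comm_quantale) vcat \<Rightarrow> ('b, 'v) vcat \<Rightarrow> ('a \<Rightarrow> 'b) \<Rightarrow> bool" where
  "vcodense X Y f \<longleftrightarrow>
     (\<forall>y\<in>Obj Y. \<exists>\<nu>\<in>Obj (vexp vbase X).
        is_vinf Y (\<lambda>y'. SUP x\<in>Obj X. Hom Y (f x) y' * \<nu> x) y)"

text \<open>Meets in the underlying preorder. They are only determined up to isomorphism;
  \<open>vmeet\<close> chooses one, and \<open>is_vmeet_vmeet\<close> shows that in a complete \<open>V\<close>-category
  there is one to choose.\<close>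

definition is_vmeet :: "('a, 'v::comm_quantale) vcat \<Rightarrow> 'a set \<Rightarrow> 'a \<Rightarrow> bool" where
  "is_vmeet X S m \<longleftrightarrow> m \<in> Obj X \<and> (\<forall>s\<in>S. vle X m s) \<and>
     (\<forall>x\<in>Obj X. (\<forall>s\<in>S. vle X x s) \<longrightarrow> vle X x m)"

definition vmeet :: "('a, 'v::comm_quantale) vcat \<Rightarrow> 'a set \<Rightarrow> 'a" where
  "vmeet X S = (SOME m. is_vmeet X S m)"

lemma is_vmeet_vmeet:
  fixes X :: "('a, 'v::comm_quantale) vcat"
  assumes cat: "vcategory X" and comp: "vcomplete X" and S: "S \<subseteq> Obj X"
  shows "is_vmeet X S (vmeet X S)"
proof -
  define w where "w = (\<lambda>y. SUP s\<in>S. Hom X s y)"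
  have trans: "Hom X x y * Hom X y z \<le> Hom X x z"
    if "x \<in> Obj X" "y \<in> Obj X" "z \<in> Obj X" for x y z
    using cat that unfolding vcategory_def by blast
  have w_mono: "Hom X x y \<le> (w x \<rightarrow>\<^sub>q w y)" if xy: "x \<in> Obj X" "y \<in> Obj X" for x y
  proof -
    have "Hom X x y * w x = (SUP u\<in>(\<lambda>s. Hom X s x) ` S. Hom X x y * u)"
      unfolding w_def by (rule mult_Sup)
    also have "\<dots> \<le> w y"
    proof (rule SUP_least)
      fix u assume "u \<in> (\<lambda>s. Hom X s x) ` S"
      then obtain s where s: "s \<in> S" and u: "u = Hom X s x" by blast
      have "Hom X x y * u \<le> Hom X s y"
        using trans[of s x y] s S xy by (auto simp: u mult.commute)
      also have "\<dots> \<le> w y" unfolding w_def using s by (rule SUP_upper)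
      finally show "Hom X x y * u \<le> w y" .
    qed
    finally show ?thesis by (simp add: qimp_adjoint)
  qed
  have "restrict w (Obj X) \<in> Obj (vexp vbase X)"
    using w_mono by (auto simp: vexp_def vbase_def vfunctor_def)
  then obtain i where "is_vinf X (restrict w (Obj X)) i"
    using comp unfolding vcomplete_def by blast
  then have i: "i \<in> Obj X"
    and hom_i: "\<And>x. x \<in> Obj X \<Longrightarrow> Hom X x i = (INF y\<in>Obj X. w y \<rightarrow>\<^sub>q Hom X x y)"
    unfolding is_vinf_def by (auto cong: INF_cong)
  have refl: "1 \<le> Hom X x x" if "x \<in> Obj X" for x
    using cat that unfolding vcategory_def by blast
  have "vle X i s" if s: "s \<in> S" for s
  proof -
    have sX: "s \<in> Obj X" using s S by blast
    have "1 \<le> Hom X i i" using refl i by blast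
    also have "\<dots> \<le> (w s \<rightarrow>\<^sub>q Hom X i s)"
      unfolding hom_i[OF i] using sX by (rule INF_lower)
    finally have "1 * w s \<le> Hom X i s" by (simp only: qimp_adjoint)
    moreover have "1 \<le> w s"
    proof -
      have "1 \<le> Hom X s s" using refl sX .
      also have "\<dots> \<le> w s" unfolding w_def using s by (rule SUP_upper)
      finally show ?thesis .
    qed
    ultimately show ?thesis unfolding vle_def by simp
  qed
  moreover have "vle X x i" if x: "x \<in> Obj X" and le: "\<forall>s\<in>S. vle X x s" for x
  proof -
    have "1 \<le> (w y \<rightarrow>\<^sub>q Hom X x y)" if y: "y \<in> Obj X" for y
    proof -
      have "w y \<le> Hom X x y" unfolding w_def
      proof (rule SUP_least)
        fix s assume s: "s \<in> S"
        have "Hom X s y * 1 \<le> Hom X s y * Hom X x s"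
          using le s unfolding vle_def by (intro mult_mono_q) blast
        also have "\<dots> \<le> Hom X x y"
          using trans[of x s y] x y s S by (auto simp: mult.commute)
        finally show "Hom X s y \<le> Hom X x y" by simp
      qed
      then show ?thesis by (simp add: qimp_adjoint[symmetric])
    qed
    then show ?thesis unfolding vle_def hom_i[OF x] by (intro INF_greatest)
  qed
  ultimately have "is_vmeet X S i" unfolding is_vmeet_def using i by blast
  then show ?thesis unfolding vmeet_def by (rule someI)
qed

definition phi_up ::
  "('x, 'v::comm_quantale) vcat \<Rightarrow> ('z \<times> 'y \<Rightarrow> 'x) \<Rightarrow> ('a, 'v) vcat \<Rightarrow> ('b, 'v) vcat \<Rightarrow>
   ('a \<times> 'b \<Rightarrow> 'z) \<Rightarrow> ('a \<Rightarrow> 'y) \<Rightarrow> ('b \<Rightarrow> 'x)" where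
  "phi_up X limp A B \<phi> \<mu> =
     (\<lambda>b\<in>Obj B. vmeet X ((\<lambda>a. limp (\<phi> (a, b), \<mu> a)) ` Obj A))"

definition phi_down ::
  "('y, 'v::comm_quantale) vcat \<Rightarrow> ('x \<times> 'z \<Rightarrow> 'y) \<Rightarrow> ('a, 'v) vcat \<Rightarrow> ('b, 'v) vcat \<Rightarrow>
   ('a \<times> 'b \<Rightarrow> 'z) \<Rightarrow> ('b \<Rightarrow> 'x) \<Rightarrow> ('a \<Rightarrow> 'y)" where
  "phi_down Y rimp A B \<phi> \<nu> =
     (\<lambda>a\<in>Obj A. vmeet Y ((\<lambda>b. rimp (\<nu> b, \<phi> (a, b))) ` Obj B))"

definition Mphi ::
  "('x, 'v::comm_quantale) vcat \<Rightarrow> ('y, 'v) vcat \<Rightarrow> ('z \<times> 'y \<Rightarrow> 'x) \<Rightarrow> ('x \<times> 'z \<Rightarrow> 'y) \<Rightarrow>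
   ('a, 'v) vcat \<Rightarrow> ('b, 'v) vcat \<Rightarrow> ('a \<times> 'b \<Rightarrow> 'z) \<Rightarrow> ('a \<Rightarrow> 'y, 'v) vcat" where
  "Mphi X Y limp rimp A B \<phi> =
     \<lparr>Obj = {\<mu> \<in> Obj (vexp Y (vop A)).
        viso (vexp Y (vop A)) (phi_down Y rimp A B \<phi> (phi_up X limp A B \<phi> \<mu>)) \<mu>},
      Hom = Hom (vexp Y (vop A))\<rparr>"

end

theory Submission
  imports Defs
begin

text \<open>
  Put \<open>R ((a, y), (b, x)) = Z (x \<circledast> y, \<phi> (a, b))\<close>, a \<open>V\<close>-valued relation between \<open>A \<otimes>\<^sub>V Y\<close> and
  \<open>B \<otimes>\<^sub>V vop X\<close>. The theorem is the representation theorem for concept lattices, applied to \<open>R\<close>: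
  like a complete lattice, a complete category is determined up to equivalence by a dense
  (join-dense) and a codense (meet-dense) family together with the homs from the first to the second.
  What the completeness of \<open>X\<close> and \<open>Y\<close> and the two-variable adjunction add is that the lower and
  upper sets which occur, a priori \<open>V\<close>-valued functions of \<open>(a, y)\<close> and \<open>(b, x)\<close>, are
  represented by functors \<open>\<mu>\<close> and \<open>\<nu>\<close> with values in \<open>Y\<close> and \<open>X\<close>: the function
  \<open>Hom Y y (\<mu> a)\<close> of \<open>(a, y)\<close> corresponds to \<open>\<mu>\<close>, and dually for \<open>\<nu>\<close>. Under this correspondence,
  which is the Yoneda lemma, \<open>\<phi>\<^sub>\<up>\<close> and \<open>\<phi>\<^sup>\<down>\<close> become the polarities of \<open>R\<close>
  (\<open>hom_up_yoneda\<close>, \<open>hom_down_yoneda\<close>).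

  Density of \<open>f\<close> into \<open>C\<close> is used throughout as the identity
  \<open>C (c, c') = \<Sqinter>x. C (f x, c) \<rightarrow> C (f x, c')\<close>, without any choice of weights (\<open>vdense_iff\<close>).

  Given an equivalence of \<open>C\<close> with \<open>M\<phi>\<close>, it suffices to generate \<open>M\<phi>\<close>. The two polarities are
  adjoint (\<open>hom_down_up\<close>), so that \<open>M\<phi>\<close> is reflective in a category with pointwise limits and hence
  complete. As \<open>\<beta> (b, x)\<close> take \<open>a \<mapsto> x \<searrow> \<phi> (a, b)\<close>, which is a fixed point, and as \<open>\<alpha> (a, y)\<close> the
  image under \<open>\<phi>\<^sup>\<down>\<close> of \<open>b \<mapsto> \<phi> (a, b) \<swarrow> y\<close>. Homs out of \<open>\<alpha> (a, y)\<close> evaluate a fixed point at \<open>a\<close>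
  (\<open>hom_down_col\<close>) and homs into \<open>\<beta> (b, x)\<close> evaluate its image under \<open>\<phi>\<^sub>\<up>\<close> at \<open>b\<close> (\<open>hom_row\<close>); density,
  codensity and the formula for the homs between them all follow from this.

  Conversely, let \<open>C\<close> be complete with such \<open>\<alpha>\<close> and \<open>\<beta>\<close>. Codensity makes every \<open>\<alpha> (a, _)\<close> a left
  adjoint (\<open>\<alpha>_right_adjoint\<close>), and the values at \<open>c\<close> of the right adjoints form a functor \<open>nerve c\<close>
  from \<open>vop A\<close> to \<open>Y\<close>. Density makes the nerve fully faithful (\<open>hom_nerve\<close>), density and
  codensity together make it a fixed point (\<open>nerve_in_M\<close>), and weighted joins in \<open>C\<close> realize every
  fixed point as a nerve (\<open>nerve_essentially_surjective\<close>).
\<close>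

section \<open>Residuation in a commutative quantale\<close>

lemma eq_if_same_lower_bounds:
  fixes a b :: "'v::order"
  assumes "\<And>v. v \<le> a \<longleftrightarrow> v \<le> b"
  shows "a = b"
  using assms by (meson antisym order_refl)

lemma mult_mono2_q:
  fixes x :: "'v::comm_quantale"
  assumes "x \<le> x'" "y \<le> y'"
  shows "x * y \<le> x' * y'"
  by (metis assms mult.commute mult_mono_q order_trans)

lemma le_mult_left_unit:
  fixes x :: "'v::comm_quantale"
  assumes "1 \<le> u"
  shows "x \<le> u * x"
  using mult_mono2_q[OF assms order_refl, of x] by simp

lemma le_qimp_iff:
  fixes x :: "'v::comm_quantale"
  shows "x \<le> (y \<rightarrow>\<^sub>q z) \<longleftrightarrow> x * y \<le> z"
  by (rule qimp_adjoint[symmetric])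

lemma SUP_mult_le_iff:
  fixes c :: "'v::comm_quantale"
  shows "v * (SUP i\<in>I. f i) \<le> c \<longleftrightarrow> (\<forall>i\<in>I. v * f i \<le> c)"
  by (simp add: mult_Sup image_image SUP_le_iff)

section \<open>Homs, duality and the Yoneda lemma\<close>

lemma hom_refl: "vcategory X \<Longrightarrow> x \<in> Obj X \<Longrightarrow> 1 \<le> Hom X x x"
  by (simp add: vcategory_def)

lemma hom_comp:
  "vcategory X \<Longrightarrow> x \<in> Obj X \<Longrightarrow> y \<in> Obj X \<Longrightarrow> z \<in> Obj X \<Longrightarrow>
   Hom X x y * Hom X y z \<le> Hom X x z"
  by (simp add: vcategory_def)

lemma hom_comp_le:
  assumes "vcategory X" "x \<in> Obj X" "y \<in> Obj X" "z \<in> Obj X"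
    and "u \<le> Hom X x y" "v \<le> Hom X y z"
  shows "u * v \<le> Hom X x z"
  using mult_mono2_q[OF assms(5,6)] hom_comp[OF assms(1-4)] by (rule order_trans)

lemma Obj_vop [simp]: "Obj (vop X) = Obj X"
  and Hom_vop [simp]: "Hom (vop X) x y = Hom X y x"
  and vop_vop [simp]: "vop (vop X) = X"
  by (simp_all add: vop_def)

lemma vcategory_vop [simp]: "vcategory (vop X) \<longleftrightarrow> vcategory X"
  unfolding vcategory_def Obj_vop Hom_vop
  by (subst mult.commute) blast

lemma vfunctor_vop [simp]: "vfunctor (vop X) (vop Y) f \<longleftrightarrow> vfunctor X Y f"
  by (auto simp: vfunctor_def)

lemma Obj_vtensor [simp]: "Obj (X \<otimes>\<^sub>V Y) = Obj X \<times> Obj Y"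
  and Hom_vtensor [simp]: "Hom (X \<otimes>\<^sub>V Y) (x, y) (x', y') = Hom X x x' * Hom Y y y'"
  by (simp_all add: vtensor_def)

lemma Hom_vexp: "Hom (vexp Y X) f g = (INF x\<in>Obj X. Hom Y (f x) (g x))"
  by (simp add: vexp_def)

lemma mem_vexp_iff:
  "f \<in> Obj (vexp Y X) \<longleftrightarrow> f \<in> extensional (Obj X) \<and> (\<forall>x\<in>Obj X. f x \<in> Obj Y) \<and>
     (\<forall>x\<in>Obj X. \<forall>x'\<in>Obj X. Hom X x x' \<le> Hom Y (f x) (f x'))"
  by (auto simp: vexp_def vfunctor_def PiE_iff)

lemma mem_vexp_vbase_iff:
  "f \<in> Obj (vexp vbase X) \<longleftrightarrow> f \<in> extensional (Obj X) \<and>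
     (\<forall>x\<in>Obj X. \<forall>x'\<in>Obj X. Hom X x x' * f x \<le> f x')"
  by (simp add: mem_vexp_iff vbase_def le_qimp_iff)

lemma vcategory_vexp:
  assumes Y: "vcategory Y"
  shows "vcategory (vexp Y X)"
  unfolding vcategory_def
proof (intro conjI ballI)
  fix f assume "f \<in> Obj (vexp Y X)"
  then show "1 \<le> Hom (vexp Y X) f f"
    by (auto simp: Hom_vexp mem_vexp_iff intro!: INF_greatest hom_refl[OF Y])
next
  fix f g h assume "f \<in> Obj (vexp Y X)" "g \<in> Obj (vexp Y X)" "h \<in> Obj (vexp Y X)"
  then have "Hom (vexp Y X) f g * Hom (vexp Y X) g h \<le> Hom Y (f x) (h x)" if "x \<in> Obj X" for x
    unfolding Hom_vexp using that
    by (intro hom_comp_le[OF Y, of "f x" "g x" "h x"]) (auto simp: mem_vexp_iff intro: INF_lower)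
  then show "Hom (vexp Y X) f g * Hom (vexp Y X) g h \<le> Hom (vexp Y X) f h"
    unfolding Hom_vexp[of Y X f h] by (rule INF_greatest)
qed

lemma viso_hom_left:
  assumes X: "vcategory X" and ob: "x \<in> Obj X" "x' \<in> Obj X" "y \<in> Obj X" and "viso X x x'"
  shows "Hom X x y = Hom X x' y"
  using hom_comp_le[OF X, of x x' y 1 "Hom X x' y"] hom_comp_le[OF X, of x' x y 1 "Hom X x y"] assms
  by (auto simp: viso_def vle_def intro: antisym)

lemma viso_hom_right:
  assumes X: "vcategory X" and ob: "x \<in> Obj X" "x' \<in> Obj X" "y \<in> Obj X" and "viso X x x'"
  shows "Hom X y x = Hom X y x'"
  using viso_hom_left[of "vop X" x x' y] assms by (auto simp: viso_def vle_def)

lemma viso_sym: "viso X x y \<Longrightarrow> viso X y x"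
  by (simp add: viso_def)

lemma hom_yoneda:
  assumes X: "vcategory X" and ob: "x \<in> Obj X" "z \<in> Obj X"
  shows "Hom X x z = (INF y\<in>Obj X. Hom X y x \<rightarrow>\<^sub>q Hom X y z)"
proof (rule antisym)
  show "Hom X x z \<le> (INF y\<in>Obj X. Hom X y x \<rightarrow>\<^sub>q Hom X y z)"
    using hom_comp[OF X _ ob] by (auto intro!: INF_greatest simp: le_qimp_iff mult.commute)
  let ?i = "INF y\<in>Obj X. Hom X y x \<rightarrow>\<^sub>q Hom X y z"
  have "?i \<le> (Hom X x x \<rightarrow>\<^sub>q Hom X x z)"
    using ob(1) by (rule INF_lower)
  \<comment> \<open>Evaluate the transformation at the identity of \<open>x\<close>.\<close>
  then have "Hom X x x * ?i \<le> Hom X x z" by (simp only: le_qimp_iff mult.commute)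
  then show "?i \<le> Hom X x z"
    by (rule order_trans[OF le_mult_left_unit[OF hom_refl[OF X ob(1)]]])
qed

lemma viso_vexpI:
  assumes Y: "vcategory Y" and ob: "f \<in> Obj (vexp Y X)" "g \<in> Obj (vexp Y X)"
    and eq: "\<And>x y. x \<in> Obj X \<Longrightarrow> y \<in> Obj Y \<Longrightarrow> Hom Y y (f x) = Hom Y y (g x)"
  shows "viso (vexp Y X) f g"
proof -
  have "1 \<le> Hom Y (f x) (g x)" "1 \<le> Hom Y (g x) (f x)" if x: "x \<in> Obj X" for x
    using eq[OF x, of "f x"] eq[OF x, of "g x"] hom_refl[OF Y, of "f x"] hom_refl[OF Y, of "g x"]
      ob x by (auto simp: mem_vexp_iff)
  then show ?thesis by (auto simp: viso_def vle_def Hom_vexp intro!: INF_greatest)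
qed

section \<open>Weighted meets in a complete category\<close>

text \<open>Meets of arbitrary weighted families are the form in which completeness is used. A family need
  not be indexed by the category itself, nor be a functor; for the constant weight \<open>1\<close> this is a
  meet in the underlying preorder, for a one-element family it is the cotensor.\<close>

definition is_wmeet ::
  "('a, 'v::comm_quantale) vcat \<Rightarrow> 'i set \<Rightarrow> ('i \<Rightarrow> 'v) \<Rightarrow> ('i \<Rightarrow> 'a) \<Rightarrow> 'a \<Rightarrow> bool" where
  "is_wmeet X I w d m \<longleftrightarrow> m \<in> Obj X \<and>
     (\<forall>x\<in>Obj X. Hom X x m = (INF i\<in>I. w i \<rightarrow>\<^sub>q Hom X x (d i)))"

text \<open>Generate a copresheaf freely from the weighted family; by the Yoneda lemma its
  infimum only sees the generators.\<close>

lemma INF_free_presheaf: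
  assumes X: "vcategory X" and d: "\<And>i. i \<in> I \<Longrightarrow> d i \<in> Obj X" and x: "x \<in> Obj X"
  shows "(INF y\<in>Obj X. (SUP i\<in>I. Hom X (d i) y * w i) \<rightarrow>\<^sub>q Hom X x y) =
         (INF i\<in>I. w i \<rightarrow>\<^sub>q Hom X x (d i))"
proof (rule eq_if_same_lower_bounds)
  fix v
  have "(\<forall>y\<in>Obj X. v * (Hom X (d i) y * w i) \<le> Hom X x y) \<longleftrightarrow> v * w i \<le> Hom X x (d i)"
    if i: "i \<in> I" for i
  proof
    assume "\<forall>y\<in>Obj X. v * (Hom X (d i) y * w i) \<le> Hom X x y"
    then have "v * (Hom X (d i) (d i) * w i) \<le> Hom X x (d i)" using d i by blast
    moreover have "v * w i \<le> v * (Hom X (d i) (d i) * w i)"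
      using hom_refl[OF X d[OF i]] by (intro mult_mono_q le_mult_left_unit)
    ultimately show "v * w i \<le> Hom X x (d i)" by (rule order_trans[rotated])
  next
    assume "v * w i \<le> Hom X x (d i)"
    from hom_comp_le[OF X x d[OF i] _ this order_refl]
    show "\<forall>y\<in>Obj X. v * (Hom X (d i) y * w i) \<le> Hom X x y" by (simp add: ac_simps)
  qed
  then show "v \<le> (INF y\<in>Obj X. (SUP i\<in>I. Hom X (d i) y * w i) \<rightarrow>\<^sub>q Hom X x y) \<longleftrightarrow>
      v \<le> (INF i\<in>I. w i \<rightarrow>\<^sub>q Hom X x (d i))"
    by (auto simp: le_INF_iff le_qimp_iff SUP_mult_le_iff)
qed

lemma free_copresheaf:
  assumes X: "vcategory X" and d: "\<And>i. i \<in> I \<Longrightarrow> d i \<in> Obj X"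
  shows "(\<lambda>y\<in>Obj X. SUP i\<in>I. Hom X (d i) y * w i) \<in> Obj (vexp vbase X)"
proof -
  have "Hom X x x' * (Hom X (d i) x * w i) \<le> (SUP i\<in>I. Hom X (d i) x' * w i)"
    if "x \<in> Obj X" "x' \<in> Obj X" "i \<in> I" for x x' i
  proof -
    have "Hom X (d i) x * Hom X x x' * w i \<le> Hom X (d i) x' * w i"
      using hom_comp[OF X d, of i x x'] that by (intro mult_mono2_q) auto
    also have "\<dots> \<le> (SUP i\<in>I. Hom X (d i) x' * w i)"
      using that by (intro SUP_upper)
    finally show ?thesis by (simp add: ac_simps)
  qed
  then show ?thesis
    by (auto simp: mem_vexp_vbase_iff SUP_mult_le_iff)
qed

lemma is_vinf_restrict: "is_vinf X (restrict \<nu> (Obj X)) m \<longleftrightarrow> is_vinf X \<nu> m"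
proof -
  have "(INF y\<in>Obj X. restrict \<nu> (Obj X) y \<rightarrow>\<^sub>q Hom X x y) = (INF y\<in>Obj X. \<nu> y \<rightarrow>\<^sub>q Hom X x y)" for x
    by (rule INF_cong) auto
  then show ?thesis by (simp add: is_vinf_def)
qed

lemma is_vinf_free_copresheaf_iff:
  assumes X: "vcategory X" and d: "\<And>i. i \<in> I \<Longrightarrow> d i \<in> Obj X"
  shows "is_vinf X (\<lambda>y. SUP i\<in>I. Hom X (d i) y * w i) m \<longleftrightarrow> is_wmeet X I w d m"
  unfolding is_vinf_def is_wmeet_def
  using INF_free_presheaf[of X I d _ w] X d by simp

lemma ex_wmeet:
  assumes X: "vcategory X" "vcomplete X" and d: "\<And>i. i \<in> I \<Longrightarrow> d i \<in> Obj X"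
  shows "\<exists>m. is_wmeet X I w d m"
proof -
  have "(\<lambda>y\<in>Obj X. SUP i\<in>I. Hom X (d i) y * w i) \<in> Obj (vexp vbase X)"
    using X(1) d by (rule free_copresheaf)
  then obtain m where "is_vinf X (\<lambda>y\<in>Obj X. SUP i\<in>I. Hom X (d i) y * w i) m"
    using X(2) unfolding vcomplete_def by blast
  then have "is_wmeet X I w d m"
    unfolding is_vinf_restrict using is_vinf_free_copresheaf_iff[of X I d w m] X(1) d by simp
  then show ?thesis ..
qed

lemma vcompleteI:
  assumes "\<And>\<nu>. \<exists>m. is_wmeet X (Obj X) \<nu> (\<lambda>y. y) m"
  shows "vcomplete X"
  using assms by (auto simp: vcomplete_def is_wmeet_def is_vinf_def)

text \<open>A join is the meet of its upper bounds, each taken to the degree to which it is one.\<close>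

lemma vcomplete_vop:
  assumes X: "vcategory X" "vcomplete X"
  shows "vcomplete (vop X)"
proof (rule vcompleteI)
  fix \<nu> :: "'a \<Rightarrow> 'b"
  define ub where "ub = (\<lambda>z. INF y\<in>Obj X. \<nu> y \<rightarrow>\<^sub>q Hom X y z)"
  have ub_le: "ub z * \<nu> y \<le> Hom X y z" if "y \<in> Obj X" for y z
    unfolding ub_def le_qimp_iff[symmetric] using that by (rule INF_lower)
  obtain m where m: "m \<in> Obj X"
    and hom_m: "\<And>x. x \<in> Obj X \<Longrightarrow> Hom X x m = (INF z\<in>Obj X. ub z \<rightarrow>\<^sub>q Hom X x z)"
    using ex_wmeet[OF X, of "Obj X" "\<lambda>y. y" ub] by (auto simp: is_wmeet_def)
  \<comment> \<open>This is the universal property of the join of \<open>\<nu>\<close>.\<close>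
  have "Hom X m z = ub z" if z: "z \<in> Obj X" for z
  proof (rule antisym)
    have "\<nu> y \<le> Hom X y m" if y: "y \<in> Obj X" for y
      using ub_le[OF y] by (auto simp: hom_m[OF y] le_qimp_iff mult.commute intro!: INF_greatest)
    then show "Hom X m z \<le> ub z"
      using hom_comp_le[OF X(1) _ m z] by (auto simp: ub_def le_qimp_iff mult.commute intro!: INF_greatest)
    have "1 \<le> (ub z \<rightarrow>\<^sub>q Hom X m z)"
      using hom_refl[OF X(1) m] z unfolding hom_m[OF m] le_INF_iff by blast
    then show "ub z \<le> Hom X m z" by (simp add: le_qimp_iff)
  qed
  then show "\<exists>m. is_wmeet (vop X) (Obj (vop X)) \<nu> (\<lambda>y. y) m"
    using m by (auto simp: is_wmeet_def ub_def)
qed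

lemma
  assumes X: "vcategory X" "vcomplete X" and S: "S \<subseteq> Obj X"
  shows vmeet_in: "vmeet X S \<in> Obj X"
    and hom_vmeet: "x \<in> Obj X \<Longrightarrow> Hom X x (vmeet X S) = (INF s\<in>S. Hom X x s)"
proof -
  have v: "is_vmeet X S (vmeet X S)" using is_vmeet_vmeet[OF X S] .
  then show mX: "vmeet X S \<in> Obj X" by (simp add: is_vmeet_def)
  have one: "(1 \<rightarrow>\<^sub>q u) = u" for u :: 'b
    by (rule eq_if_same_lower_bounds) (simp add: le_qimp_iff)
  obtain m where m: "m \<in> Obj X"
    and hom_m: "\<And>x. x \<in> Obj X \<Longrightarrow> Hom X x m = (INF s\<in>S. Hom X x s)"
    using ex_wmeet[OF X, of S "\<lambda>s. s" "\<lambda>_. 1"] S by (auto simp: is_wmeet_def one)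
  have "vle X (vmeet X S) m"
    using v mX by (auto simp: is_vmeet_def vle_def hom_m intro!: INF_greatest)
  moreover have "\<forall>s\<in>S. vle X m s"
    using hom_refl[OF X(1) m] unfolding vle_def hom_m[OF m] le_INF_iff .
  then have "vle X m (vmeet X S)" using v m by (auto simp: is_vmeet_def)
  ultimately show "Hom X x (vmeet X S) = (INF s\<in>S. Hom X x s)" if x: "x \<in> Obj X"
    using viso_hom_right[OF X(1) mX m x] hom_m[OF x] by (simp add: viso_def)
qed

section \<open>Density\<close>

lemma vcodense_eq_vdense_vop: "vcodense X Y f \<longleftrightarrow> vdense (vop X) (vop Y) f"
  by (simp add: vcodense_def vdense_def is_vinf_def is_vsup_def)

text \<open>If \<open>y\<close> is a weighted meet of values of \<open>f\<close> at all, then the largest possible weight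
  \<open>Hom Y y (f x)\<close> works too. This turns codensity into an identity free of weights, saying that
  the functor from \<open>Y\<close> to \<open>V\<close>-valued functions that it induces is fully faithful.\<close>

lemma vcodense_iff:
  assumes Y: "vcategory Y" and f: "vfunctor X Y f"
  shows "vcodense X Y f \<longleftrightarrow>
    (\<forall>y\<in>Obj Y. \<forall>z\<in>Obj Y. Hom Y z y = (INF x\<in>Obj X. Hom Y y (f x) \<rightarrow>\<^sub>q Hom Y z (f x)))"
    (is "_ \<longleftrightarrow> ?R")
proof -
  have fY: "f x \<in> Obj Y" if "x \<in> Obj X" for x using f that by (auto simp: vfunctor_def)
  have iff: "is_vinf Y (\<lambda>y'. SUP x\<in>Obj X. Hom Y (f x) y' * w x) y \<longleftrightarrow> is_wmeet Y (Obj X) w f y" for w y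
    using Y fY by (rule is_vinf_free_copresheaf_iff)
  show ?thesis
  proof
    assume cod: "vcodense X Y f"
    show ?R
    proof (intro ballI antisym)
      fix y z assume y: "y \<in> Obj Y" and z: "z \<in> Obj Y"
      show "Hom Y z y \<le> (INF x\<in>Obj X. Hom Y y (f x) \<rightarrow>\<^sub>q Hom Y z (f x))"
        using hom_comp[OF Y z y fY] by (auto intro!: INF_greatest simp: le_qimp_iff)
      obtain \<nu> where hom: "\<And>z. z \<in> Obj Y \<Longrightarrow> Hom Y z y = (INF x\<in>Obj X. \<nu> x \<rightarrow>\<^sub>q Hom Y z (f x))"
        using cod y unfolding vcodense_def iff is_wmeet_def by blast
      \<comment> \<open>Any weight that presents \<open>y\<close> is below the canonical one, as the identity of \<open>y\<close> shows.\<close>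
      have le: "\<nu> x \<le> Hom Y y (f x)" if "x \<in> Obj X" for x
        using hom_refl[OF Y y] that unfolding hom[OF y] le_INF_iff le_qimp_iff by simp
      show "(INF x\<in>Obj X. Hom Y y (f x) \<rightarrow>\<^sub>q Hom Y z (f x)) \<le> Hom Y z y"
        unfolding hom[OF z]
      proof (rule INF_mono)
        fix x assume x: "x \<in> Obj X"
        have "(Hom Y y (f x) \<rightarrow>\<^sub>q Hom Y z (f x)) \<le> (\<nu> x \<rightarrow>\<^sub>q Hom Y z (f x))"
          using mult_mono_q[OF le[OF x]] unfolding le_qimp_iff
          by (meson le_qimp_iff order_refl order_trans)
        then show "\<exists>n\<in>Obj X. (Hom Y y (f n) \<rightarrow>\<^sub>q Hom Y z (f n)) \<le> (\<nu> x \<rightarrow>\<^sub>q Hom Y z (f x))"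
          using x by blast
      qed
    qed
  next
    assume R: ?R
    show "vcodense X Y f"
      unfolding vcodense_def iff
    proof
      fix y assume y: "y \<in> Obj Y"
      have "Hom X x x' * Hom Y y (f x) \<le> Hom Y y (f x')" if "x \<in> Obj X" "x' \<in> Obj X" for x x'
        using hom_comp_le[OF Y y fY fY order_refl, of x x' "Hom X x x'"] f that
        by (simp add: vfunctor_def mult.commute)
      then have "(\<lambda>x\<in>Obj X. Hom Y y (f x)) \<in> Obj (vexp vbase X)"
        by (simp add: mem_vexp_vbase_iff)
      moreover have "is_wmeet Y (Obj X) (\<lambda>x\<in>Obj X. Hom Y y (f x)) f y"
        using R y by (simp add: is_wmeet_def cong: INF_cong)
      ultimately show "\<exists>\<nu>\<in>Obj (vexp vbase X). is_wmeet Y (Obj X) \<nu> f y"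
        by blast
    qed
  qed
qed

lemma vdense_iff:
  assumes Y: "vcategory Y" and f: "vfunctor X Y f"
  shows "vdense X Y f \<longleftrightarrow>
    (\<forall>y\<in>Obj Y. \<forall>z\<in>Obj Y. Hom Y y z = (INF x\<in>Obj X. Hom Y (f x) y \<rightarrow>\<^sub>q Hom Y (f x) z))"
  using vcodense_iff[of "vop Y" "vop X" f] assms vcodense_eq_vdense_vop[of "vop X" "vop Y" f]
  by simp

section \<open>Equivalences\<close>

text \<open>An equivalence is an adjunction in both directions; exchanging \<open>f\<close> and \<open>g\<close> gives the other one.\<close>

lemma hom_equivalence:
  assumes C: "vcategory C" and D: "vcategory D"
    and f: "vfunctor C D f" and g: "vfunctor D C g"
    and gf: "\<forall>c\<in>Obj C. viso C (g (f c)) c" and fg: "\<forall>d\<in>Obj D. viso D (f (g d)) d"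
    and c: "c \<in> Obj C" and d: "d \<in> Obj D"
  shows "Hom D d (f c) = Hom C (g d) c"
proof (rule antisym)
  have ob: "f c \<in> Obj D" "g d \<in> Obj C" "f (g d) \<in> Obj D" "g (f c) \<in> Obj C"
    using f g c d by (auto simp: vfunctor_def)
  have "Hom D d (f c) \<le> Hom C (g d) (g (f c))"
    using g d ob by (auto simp: vfunctor_def)
  also have "\<dots> = Hom C (g d) c" using viso_hom_right[OF C ob(4) c ob(2)] gf c by blast
  finally show "Hom D d (f c) \<le> Hom C (g d) c" .
  have "Hom C (g d) c \<le> Hom D (f (g d)) (f c)"
    using f c ob by (auto simp: vfunctor_def)
  also have "\<dots> = Hom D d (f c)" using viso_hom_left[OF D ob(3) d ob(1)] fg d by blast
  finally show "Hom C (g d) c \<le> Hom D d (f c)" .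
qed

lemma vequivalentI:
  assumes C: "vcategory C" and D: "vcategory D"
    and fD: "\<And>c. c \<in> Obj C \<Longrightarrow> f c \<in> Obj D"
    and ff: "\<And>c c'. c \<in> Obj C \<Longrightarrow> c' \<in> Obj C \<Longrightarrow> Hom D (f c) (f c') = Hom C c c'"
    and eso: "\<And>d. d \<in> Obj D \<Longrightarrow> \<exists>c\<in>Obj C. viso D (f c) d"
  shows "vequivalent C D"
proof -
  obtain g where g: "\<And>d. d \<in> Obj D \<Longrightarrow> g d \<in> Obj C \<and> viso D (f (g d)) d"
    using eso by metis
  have hom_g: "Hom C (g d) c = Hom D d (f c)" "Hom C c (g d) = Hom D (f c) d"
    if "d \<in> Obj D" "c \<in> Obj C" for c d
    using ff[of "g d" c] ff[of c "g d"] viso_hom_left[OF D, of "f (g d)" d "f c"]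
      viso_hom_right[OF D, of "f (g d)" d "f c"] that g fD by auto
  have "vfunctor D C g"
    unfolding vfunctor_def
  proof (intro conjI ballI)
    fix d d' assume d: "d \<in> Obj D" "d' \<in> Obj D"
    have "Hom C (g d) (g d') = Hom D d (f (g d'))" using hom_g d g by blast
    also have "\<dots> = Hom D d d'" using viso_hom_right[OF D, of "f (g d')" d' d] d g fD by blast
    finally show "Hom D d d' \<le> Hom C (g d) (g d')" by simp
  qed (use g in auto)
  moreover have "viso C (g (f c)) c" if "c \<in> Obj C" for c
    using hom_g[of "f c" c] that fD hom_refl[OF D, of "f c"] by (auto simp: viso_def vle_def)
  ultimately show ?thesis
    unfolding vequivalent_def
    by (intro exI[of _ f] exI[of _ g]) (auto simp: vfunctor_def fD ff g)
qed

lemma vequivalent_complete: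
  assumes C: "vcategory C" and D: "vcategory D" "vcomplete D" and eq: "vequivalent C D"
  shows "vcomplete C"
proof (rule vcompleteI)
  fix \<nu> :: "'a \<Rightarrow> 'b"
  obtain f g where f: "vfunctor C D f" and g: "vfunctor D C g"
    and gf: "\<forall>c\<in>Obj C. viso C (g (f c)) c" and fg: "\<forall>d\<in>Obj D. viso D (f (g d)) d"
    using eq unfolding vequivalent_def by blast
  have ob: "\<And>c. c \<in> Obj C \<Longrightarrow> f c \<in> Obj D" "\<And>d. d \<in> Obj D \<Longrightarrow> g d \<in> Obj C"
    using f g by (auto simp: vfunctor_def)
  obtain m where m: "m \<in> Obj D"
    and hom_m: "\<And>d. d \<in> Obj D \<Longrightarrow> Hom D d m = (INF c\<in>Obj C. \<nu> c \<rightarrow>\<^sub>q Hom D d (f c))"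
    using ex_wmeet[OF D, of "Obj C" f \<nu>] ob by (auto simp: is_wmeet_def)
  have hom_gm: "Hom C x (g m) = (INF c\<in>Obj C. \<nu> c \<rightarrow>\<^sub>q Hom C x c)" if x: "x \<in> Obj C" for x
  proof -
    have "Hom C x (g m) = Hom D (f x) m"
      using hom_equivalence[OF D(1) C g f fg gf m x] .
    also have "\<dots> = (INF c\<in>Obj C. \<nu> c \<rightarrow>\<^sub>q Hom D (f x) (f c))"
      using hom_m ob x by blast
    also have "\<dots> = (INF c\<in>Obj C. \<nu> c \<rightarrow>\<^sub>q Hom C x c)"
      using hom_equivalence[OF C D(1) f g gf fg _ ob(1)[OF x]]
        viso_hom_left[OF C, of "g (f x)" x] gf x ob by (auto intro!: INF_cong)
    finally show ?thesis .
  qed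
  then show "\<exists>m. is_wmeet C (Obj C) \<nu> (\<lambda>y. y) m"
    using m ob by (auto simp: is_wmeet_def)
qed

lemma vfunctor_comp: "vfunctor P D h \<Longrightarrow> vfunctor D C g \<Longrightarrow> vfunctor P C (g \<circ> h)"
  unfolding vfunctor_def by (simp add: Pi_iff) (meson order_trans)

lemma vdense_equivalence:
  assumes C: "vcategory C" and D: "vcategory D"
    and f: "vfunctor C D f" and g: "vfunctor D C g"
    and gf: "\<forall>c\<in>Obj C. viso C (g (f c)) c" and fg: "\<forall>d\<in>Obj D. viso D (f (g d)) d"
    and h: "vfunctor P D h" and dense: "vdense P D h"
  shows "vdense P C (g \<circ> h)"
  unfolding vdense_iff[OF C vfunctor_comp[OF h g]]
proof (intro ballI)
  fix c c' assume c: "c \<in> Obj C" "c' \<in> Obj C"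
  have ob: "f c \<in> Obj D" "f c' \<in> Obj D" "g (f c) \<in> Obj C" and hob: "\<And>p. p \<in> Obj P \<Longrightarrow> h p \<in> Obj D"
    using f g h c by (auto simp: vfunctor_def)
  note hom = hom_equivalence[OF C D f g gf fg]
  have "Hom C c c' = Hom C (g (f c)) c'"
    using viso_hom_left[OF C ob(3) c] gf c by simp
  also have "\<dots> = Hom D (f c) (f c')" using hom c ob by simp
  also have "\<dots> = (INF p\<in>Obj P. Hom D (h p) (f c) \<rightarrow>\<^sub>q Hom D (h p) (f c'))"
    using dense ob unfolding vdense_iff[OF D h] by blast
  also have "\<dots> = (INF p\<in>Obj P. Hom C ((g \<circ> h) p) c \<rightarrow>\<^sub>q Hom C ((g \<circ> h) p) c')"
    using hom c hob by (auto intro!: INF_cong)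
  finally show "Hom C c c' = \<dots>" .
qed

section \<open>The Isbell adjunction of a bifunctor\<close>

lemma mem_vexp_if_hom_mono:
  assumes Y: "vcategory Y" and f: "f \<in> extensional (Obj X)" "\<And>x. x \<in> Obj X \<Longrightarrow> f x \<in> Obj Y"
    and mono: "\<And>x x' y. x \<in> Obj X \<Longrightarrow> x' \<in> Obj X \<Longrightarrow> y \<in> Obj Y \<Longrightarrow>
      Hom Y y (f x) * Hom X x x' \<le> Hom Y y (f x')"
  shows "f \<in> Obj (vexp Y X)"
proof -
  have "Hom X x x' \<le> Hom Y (f x) (f x')" if "x \<in> Obj X" "x' \<in> Obj X" for x x'
    using le_mult_left_unit[OF hom_refl[OF Y f(2)[OF that(1)]]] mono[OF that f(2)[OF that(1)]]
    by (rule order_trans)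
  then show ?thesis using f by (simp add: mem_vexp_iff)
qed

text \<open>The triangle identity of a Galois connection between \<open>E\<close> and the opposite of \<open>G\<close>. The
  hypotheses are symmetric in the two sides, so that it also gives the identity for \<open>d u d\<close>.\<close>

lemma galois_triple:
  assumes E: "vcategory E" and G: "vcategory G"
    and u: "\<And>e. e \<in> Obj E \<Longrightarrow> u e \<in> Obj G" and d: "\<And>g. g \<in> Obj G \<Longrightarrow> d g \<in> Obj E"
    and adj: "\<And>e g. e \<in> Obj E \<Longrightarrow> g \<in> Obj G \<Longrightarrow> Hom E e (d g) = Hom G g (u e)"
    and e: "e \<in> Obj E"
  shows "viso G (u (d (u e))) (u e)"
proof -
  have unit: "1 \<le> Hom E e (d (u e))" if "e \<in> Obj E" for e
    using adj[OF that u[OF that]] hom_refl[OF G u[OF that]] by simp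
  have "1 \<le> Hom G (u e) (u (d (u e)))"
    using adj[of "d (u e)" "u e"] hom_refl[OF E, of "d (u e)"] u d e by simp
  moreover have "1 * 1 \<le> Hom E e (d (u (d (u e))))"
    using hom_comp_le[OF E e _ _ unit[OF e] unit[of "d (u e)"]] u d e by blast
  ultimately show ?thesis using adj[of e "u (d (u e))"] u d e by (simp add: viso_def vle_def)
qed

locale isbell =
  fixes X :: "('x, 'v::comm_quantale) vcat" and Y :: "('y, 'v) vcat" and Z :: "('z, 'v) vcat"
    and A :: "('a, 'v) vcat" and B :: "('b, 'v) vcat"
    and ten :: "'x \<times> 'y \<Rightarrow> 'z" and limp :: "'z \<times> 'y \<Rightarrow> 'x" and rimp :: "'x \<times> 'z \<Rightarrow> 'y"
    and \<phi> :: "'a \<times> 'b \<Rightarrow> 'z"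
  assumes X: "vcategory X" "vcomplete X"
    and Y: "vcategory Y" "vcomplete Y"
    and Z: "vcategory Z"
    and adjunction: "two_var_adjunction X Y Z ten limp rimp"
    and A: "vcategory A" and B: "vcategory B"
    and \<phi>: "vfunctor (vop A \<otimes>\<^sub>V B) Z \<phi>"
begin

abbreviation "E \<equiv> vexp Y (vop A)"
abbreviation "G \<equiv> vexp X B"
abbreviation "up \<equiv> phi_up X limp A B \<phi>"
abbreviation "down \<equiv> phi_down Y rimp A B \<phi>"
abbreviation "M \<equiv> Mphi X Y limp rimp A B \<phi>"

text \<open>As a function of \<open>(a, y)\<close> and \<open>(b, x)\<close> this is a \<open>V\<close>-valued relation between
  \<open>A \<otimes>\<^sub>V Y\<close> and \<open>B \<otimes>\<^sub>V vop X\<close>. Both residuals of the two-variable adjunction enter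
  the argument only through it.\<close>

abbreviation rel :: "'a \<Rightarrow> 'b \<Rightarrow> 'x \<Rightarrow> 'y \<Rightarrow> 'v" where
  "rel a b x y \<equiv> Hom Z (ten (x, y)) (\<phi> (a, b))"

lemma E: "vcategory E" and G: "vcategory G"
  using X Y by (simp_all add: vcategory_vexp)

lemma ten_in: "x \<in> Obj X \<Longrightarrow> y \<in> Obj Y \<Longrightarrow> ten (x, y) \<in> Obj Z"
  and limp_in: "z \<in> Obj Z \<Longrightarrow> y \<in> Obj Y \<Longrightarrow> limp (z, y) \<in> Obj X"
  and rimp_in: "x \<in> Obj X \<Longrightarrow> z \<in> Obj Z \<Longrightarrow> rimp (x, z) \<in> Obj Y"
  using adjunction by (auto simp: two_var_adjunction_def vfunctor_def)

lemma \<phi>_in: "a \<in> Obj A \<Longrightarrow> b \<in> Obj B \<Longrightarrow> \<phi> (a, b) \<in> Obj Z"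
  using \<phi> by (auto simp: vfunctor_def)

lemma hom_limp: "x \<in> Obj X \<Longrightarrow> y \<in> Obj Y \<Longrightarrow> z \<in> Obj Z \<Longrightarrow> Hom X x (limp (z, y)) = Hom Z (ten (x, y)) z"
  and hom_rimp: "x \<in> Obj X \<Longrightarrow> y \<in> Obj Y \<Longrightarrow> z \<in> Obj Z \<Longrightarrow> Hom Y y (rimp (x, z)) = Hom Z (ten (x, y)) z"
  using adjunction by (auto simp: two_var_adjunction_def)

lemma hom_limp_\<phi>:
  "a \<in> Obj A \<Longrightarrow> b \<in> Obj B \<Longrightarrow> x \<in> Obj X \<Longrightarrow> y \<in> Obj Y \<Longrightarrow> Hom X x (limp (\<phi> (a, b), y)) = rel a b x y"
  and hom_rimp_\<phi>:
  "a \<in> Obj A \<Longrightarrow> b \<in> Obj B \<Longrightarrow> x \<in> Obj X \<Longrightarrow> y \<in> Obj Y \<Longrightarrow> Hom Y y (rimp (x, \<phi> (a, b))) = rel a b x y"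
  by (simp_all add: hom_limp hom_rimp \<phi>_in)

lemma \<phi>_mono:
  assumes "a \<in> Obj A" "a' \<in> Obj A" "b \<in> Obj B" "b' \<in> Obj B"
  shows "Hom A a' a * Hom B b b' \<le> Hom Z (\<phi> (a, b)) (\<phi> (a', b'))"
proof -
  have "Hom (vop A \<otimes>\<^sub>V B) (a, b) (a', b') \<le> Hom Z (\<phi> (a, b)) (\<phi> (a', b'))"
    using \<phi> assms unfolding vfunctor_def by simp
  then show ?thesis by simp
qed

lemma rel_mono_A:
  assumes "a \<in> Obj A" "a' \<in> Obj A" "b \<in> Obj B" "x \<in> Obj X" "y \<in> Obj Y"
  shows "rel a b x y * Hom A a' a \<le> rel a' b x y"
proof -
  have "Hom A a' a * 1 \<le> Hom A a' a * Hom B b b"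
    by (intro mult_mono_q hom_refl B assms)
  with \<phi>_mono[of a a' b b] assms have "Hom A a' a \<le> Hom Z (\<phi> (a, b)) (\<phi> (a', b))" by simp
  then show ?thesis
    using hom_comp_le[OF Z ten_in \<phi>_in \<phi>_in order_refl] assms by blast
qed

lemma rel_mono_B:
  assumes "a \<in> Obj A" "b \<in> Obj B" "b' \<in> Obj B" "x \<in> Obj X" "y \<in> Obj Y"
  shows "rel a b x y * Hom B b b' \<le> rel a b' x y"
proof -
  have "Hom B b b' \<le> Hom A a a * Hom B b b'"
    by (intro le_mult_left_unit hom_refl A assms)
  also have "\<dots> \<le> Hom Z (\<phi> (a, b)) (\<phi> (a, b'))"
    using \<phi>_mono[of a a b b'] assms by simp
  finally show ?thesis
    using hom_comp_le[OF Z ten_in \<phi>_in \<phi>_in order_refl] assms by blast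
qed

lemma rel_yoneda_X:
  assumes "a \<in> Obj A" "b \<in> Obj B" "u \<in> Obj X" "y \<in> Obj Y"
  shows "rel a b u y = (INF x\<in>Obj X. Hom X x u \<rightarrow>\<^sub>q rel a b x y)"
  using hom_yoneda[OF X(1), of u "limp (\<phi> (a, b), y)"] assms
  by (simp add: hom_limp_\<phi> limp_in \<phi>_in cong: INF_cong_simp)

lemma rel_yoneda_Y:
  assumes "a \<in> Obj A" "b \<in> Obj B" "x \<in> Obj X" "u \<in> Obj Y"
  shows "rel a b x u = (INF y\<in>Obj Y. Hom Y y u \<rightarrow>\<^sub>q rel a b x y)"
  using hom_yoneda[OF Y(1), of u "rimp (x, \<phi> (a, b))"] assms
  by (simp add: hom_rimp_\<phi> rimp_in \<phi>_in cong: INF_cong_simp)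

lemma
  assumes \<mu>: "\<mu> \<in> Obj E" and b: "b \<in> Obj B"
  shows up_at_in: "up \<mu> b \<in> Obj X"
    and hom_up: "x \<in> Obj X \<Longrightarrow> Hom X x (up \<mu> b) = (INF a\<in>Obj A. rel a b x (\<mu> a))"
proof -
  have \<mu>Y: "\<mu> a \<in> Obj Y" if "a \<in> Obj A" for a using \<mu> that by (simp add: mem_vexp_iff)
  have S: "(\<lambda>a. limp (\<phi> (a, b), \<mu> a)) ` Obj A \<subseteq> Obj X" using b \<mu>Y limp_in \<phi>_in by blast
  show "up \<mu> b \<in> Obj X" using vmeet_in[OF X S] b by (simp add: phi_up_def)
  show "Hom X x (up \<mu> b) = (INF a\<in>Obj A. rel a b x (\<mu> a))" if x: "x \<in> Obj X"
  proof -
    have "Hom X x (up \<mu> b) = (INF a\<in>Obj A. Hom X x (limp (\<phi> (a, b), \<mu> a)))"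
      using hom_vmeet[OF X S x] b by (simp add: phi_up_def image_image)
    also have "\<dots> = (INF a\<in>Obj A. rel a b x (\<mu> a))"
      using b x \<mu>Y by (simp add: hom_limp_\<phi> cong: INF_cong_simp)
    finally show ?thesis .
  qed
qed

lemma
  assumes \<nu>: "\<nu> \<in> Obj G" and a: "a \<in> Obj A"
  shows down_at_in: "down \<nu> a \<in> Obj Y"
    and hom_down: "y \<in> Obj Y \<Longrightarrow> Hom Y y (down \<nu> a) = (INF b\<in>Obj B. rel a b (\<nu> b) y)"
proof -
  have \<nu>X: "\<nu> b \<in> Obj X" if "b \<in> Obj B" for b using \<nu> that by (simp add: mem_vexp_iff)
  have S: "(\<lambda>b. rimp (\<nu> b, \<phi> (a, b))) ` Obj B \<subseteq> Obj Y" using a \<nu>X rimp_in \<phi>_in by blast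
  show "down \<nu> a \<in> Obj Y" using vmeet_in[OF Y S] a by (simp add: phi_down_def)
  show "Hom Y y (down \<nu> a) = (INF b\<in>Obj B. rel a b (\<nu> b) y)" if y: "y \<in> Obj Y"
  proof -
    have "Hom Y y (down \<nu> a) = (INF b\<in>Obj B. Hom Y y (rimp (\<nu> b, \<phi> (a, b))))"
      using hom_vmeet[OF Y S y] a by (simp add: phi_down_def image_image)
    also have "\<dots> = (INF b\<in>Obj B. rel a b (\<nu> b) y)"
      using a y \<nu>X by (simp add: hom_rimp_\<phi> cong: INF_cong_simp)
    finally show ?thesis .
  qed
qed

lemma E_at_in: "\<mu> \<in> Obj E \<Longrightarrow> a \<in> Obj A \<Longrightarrow> \<mu> a \<in> Obj Y"
  and G_at_in: "\<nu> \<in> Obj G \<Longrightarrow> b \<in> Obj B \<Longrightarrow> \<nu> b \<in> Obj X"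
  by (simp_all add: mem_vexp_iff)

lemma up_in:
  assumes \<mu>: "\<mu> \<in> Obj E"
  shows "up \<mu> \<in> Obj G"
proof (rule mem_vexp_if_hom_mono[OF X(1)])
  fix b b' x assume b: "b \<in> Obj B" "b' \<in> Obj B" and x: "x \<in> Obj X"
  have "Hom X x (up \<mu> b) * Hom B b b' \<le> rel a b' x (\<mu> a)" if a: "a \<in> Obj A" for a
  proof -
    have "Hom X x (up \<mu> b) \<le> rel a b x (\<mu> a)"
      unfolding hom_up[OF \<mu> b(1) x] using a by (rule INF_lower)
    then show ?thesis
      using rel_mono_B[OF a b x E_at_in[OF \<mu> a]] mult_mono2_q order_refl by (meson order_trans)
  qed
  then show "Hom X x (up \<mu> b) * Hom B b b' \<le> Hom X x (up \<mu> b')"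
    unfolding hom_up[OF \<mu> b(2) x] by (rule INF_greatest)
qed (use up_at_in[OF \<mu>] in \<open>auto simp: phi_up_def\<close>)

lemma down_in:
  assumes \<nu>: "\<nu> \<in> Obj G"
  shows "down \<nu> \<in> Obj E"
proof (rule mem_vexp_if_hom_mono[OF Y(1)])
  fix a a' y assume "a \<in> Obj (vop A)" "a' \<in> Obj (vop A)" and y: "y \<in> Obj Y"
  then have a: "a \<in> Obj A" "a' \<in> Obj A" by simp_all
  have "Hom Y y (down \<nu> a) * Hom A a' a \<le> rel a' b (\<nu> b) y" if b: "b \<in> Obj B" for b
  proof -
    have "Hom Y y (down \<nu> a) \<le> rel a b (\<nu> b) y"
      unfolding hom_down[OF \<nu> a(1) y] using b by (rule INF_lower)
    then show ?thesis
      using rel_mono_A[OF a b G_at_in[OF \<nu> b] y] mult_mono2_q order_refl by (meson order_trans)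
  qed
  then show "Hom Y y (down \<nu> a) * Hom (vop A) a a' \<le> Hom Y y (down \<nu> a')"
    unfolding hom_down[OF \<nu> a(2) y] Hom_vop by (rule INF_greatest)
qed (use down_at_in[OF \<nu>] in \<open>auto simp: phi_down_def\<close>)

text \<open>Both homs are the meet of \<open>rel a b (\<nu> b) (\<mu> a)\<close> over all \<open>a\<close> and \<open>b\<close>.\<close>

lemma hom_down_up:
  assumes "\<mu> \<in> Obj E" "\<nu> \<in> Obj G"
  shows "Hom E \<mu> (down \<nu>) = Hom G \<nu> (up \<mu>)"
  using assms INF_commute[of "\<lambda>a b. rel a b (\<nu> b) (\<mu> a)" "Obj B" "Obj A"]
  by (simp add: Hom_vexp hom_down hom_up E_at_in G_at_in cong: INF_cong_simp)

lemma up_down_up: "\<mu> \<in> Obj E \<Longrightarrow> viso G (up (down (up \<mu>))) (up \<mu>)"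
  by (rule galois_triple[OF E G up_in down_in hom_down_up])

lemma down_up_down: "\<nu> \<in> Obj G \<Longrightarrow> viso E (down (up (down \<nu>))) (down \<nu>)"
  by (rule galois_triple[OF G E down_in up_in hom_down_up[symmetric]])

text \<open>In terms of the functions that \<open>\<mu>\<close> and \<open>up \<mu>\<close> represent, \<open>up\<close> and \<open>down\<close> are the two polarities
  of the relation \<open>rel\<close>. In this form they can be compared with homs in a category that is
  densely and codensely generated.\<close>

lemma hom_up_yoneda:
  assumes \<mu>: "\<mu> \<in> Obj E" and b: "b \<in> Obj B" and x: "x \<in> Obj X"
  shows "Hom X x (up \<mu> b) = (INF (a, y)\<in>Obj A \<times> Obj Y. Hom Y y (\<mu> a) \<rightarrow>\<^sub>q rel a b x y)"
  unfolding hom_up[OF assms]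
  by (rule eq_if_same_lower_bounds)
     (auto simp: rel_yoneda_Y[OF _ b x E_at_in[OF \<mu>]] le_INF_iff)

lemma hom_down_yoneda:
  assumes \<nu>: "\<nu> \<in> Obj G" and a: "a \<in> Obj A" and y: "y \<in> Obj Y"
  shows "Hom Y y (down \<nu> a) = (INF (b, x)\<in>Obj B \<times> Obj X. Hom X x (\<nu> b) \<rightarrow>\<^sub>q rel a b x y)"
  unfolding hom_down[OF assms]
  by (rule eq_if_same_lower_bounds)
     (auto simp: rel_yoneda_X[OF a _ G_at_in[OF \<nu>] y] le_INF_iff)

lemma hom_E_yoneda:
  assumes "\<mu> \<in> Obj E" "\<mu>' \<in> Obj E"
  shows "Hom E \<mu> \<mu>' = (INF (a, y)\<in>Obj A \<times> Obj Y. Hom Y y (\<mu> a) \<rightarrow>\<^sub>q Hom Y y (\<mu>' a))"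
  by (rule eq_if_same_lower_bounds)
     (auto simp: Hom_vexp le_INF_iff hom_yoneda[OF Y(1) E_at_in[OF assms(1)] E_at_in[OF assms(2)]])

lemma hom_G_yoneda:
  assumes "\<nu> \<in> Obj G" "\<nu>' \<in> Obj G"
  shows "Hom G \<nu> \<nu>' = (INF (b, x)\<in>Obj B \<times> Obj X. Hom X x (\<nu> b) \<rightarrow>\<^sub>q Hom X x (\<nu>' b))"
  by (rule eq_if_same_lower_bounds)
     (auto simp: Hom_vexp le_INF_iff hom_yoneda[OF X(1) G_at_in[OF assms(1)] G_at_in[OF assms(2)]])

section \<open>The category of fixed points\<close>

lemma mem_M_iff: "\<mu> \<in> Obj M \<longleftrightarrow> \<mu> \<in> Obj E \<and> viso E (down (up \<mu>)) \<mu>"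
  and Hom_M: "Hom M = Hom E"
  by (simp_all add: Mphi_def)

lemma vcategory_M: "vcategory M"
  using E by (simp add: vcategory_def mem_M_iff Hom_M)

lemma viso_M: "viso M = viso E"
  by (simp add: viso_def vle_def Hom_M fun_eq_iff)

lemma down_in_M: "\<nu> \<in> Obj G \<Longrightarrow> down \<nu> \<in> Obj M"
  by (simp add: mem_M_iff down_in down_up_down)

lemma unit_down_up: "\<mu> \<in> Obj E \<Longrightarrow> 1 \<le> Hom E \<mu> (down (up \<mu>))"
  by (simp add: hom_down_up up_in hom_refl[OF G])

lemma mem_M_if_le: "\<mu> \<in> Obj E \<Longrightarrow> 1 \<le> Hom E (down (up \<mu>)) \<mu> \<Longrightarrow> \<mu> \<in> Obj M"
  by (simp add: mem_M_iff viso_def vle_def unit_down_up)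

lemma hom_to_M:
  assumes \<mu>: "\<mu> \<in> Obj E" and \<mu>': "\<mu>' \<in> Obj M"
  shows "Hom E \<mu> \<mu>' = Hom G (up \<mu>') (up \<mu>)"
proof -
  from \<mu>' have ob: "\<mu>' \<in> Obj E" "down (up \<mu>') \<in> Obj E" and "viso E (down (up \<mu>')) \<mu>'"
    by (simp_all add: mem_M_iff up_in down_in)
  then show ?thesis
    using viso_hom_right[OF E ob(2,1) \<mu>] hom_down_up[OF \<mu> up_in[OF ob(1)]] by simp
qed

text \<open>The universal property of \<open>down (up \<mu>)\<close> as the reflection of \<open>\<mu>\<close> into \<open>M\<close>.\<close>

lemma hom_down_up_left:
  assumes \<mu>: "\<mu> \<in> Obj E" and \<mu>': "\<mu>' \<in> Obj M"
  shows "Hom E (down (up \<mu>)) \<mu>' = Hom E \<mu> \<mu>'"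
proof -
  have ob: "\<mu>' \<in> Obj E" "down (up \<mu>) \<in> Obj E" using assms by (simp_all add: mem_M_iff up_in down_in)
  show ?thesis
    unfolding hom_to_M[OF \<mu> \<mu>'] hom_to_M[OF ob(2) \<mu>']
    by (intro viso_hom_right[OF G _ _ _ up_down_up] up_in ob \<mu>)
qed

text \<open>Weighted meets in \<open>E\<close> are computed pointwise, and a meet of fixed points is again one because
  \<open>M\<close> is reflective in \<open>E\<close>.\<close>

lemma complete_M: "vcomplete M"
proof (rule vcompleteI)
  fix \<nu> :: "('a \<Rightarrow> 'y) \<Rightarrow> 'v"
  have ME: "\<mu> \<in> Obj E" if "\<mu> \<in> Obj M" for \<mu> using that by (simp add: mem_M_iff)
  have "\<exists>m. is_wmeet Y (Obj M) \<nu> (\<lambda>\<mu>. \<mu> a) m" if "a \<in> Obj A" for a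
    using Y E_at_in[OF ME that] by (rule ex_wmeet)
  then obtain m0 where m0: "\<And>a. a \<in> Obj A \<Longrightarrow> is_wmeet Y (Obj M) \<nu> (\<lambda>\<mu>. \<mu> a) (m0 a)"
    by metis
  define m where "m = restrict m0 (Obj A)"
  have m_at: "m a \<in> Obj Y" if "a \<in> Obj A" for a
    using m0[OF that] that by (simp add: m_def is_wmeet_def)
  have hom_m_at: "Hom Y y (m a) = (INF \<mu>\<in>Obj M. \<nu> \<mu> \<rightarrow>\<^sub>q Hom Y y (\<mu> a))"
    if "a \<in> Obj A" "y \<in> Obj Y" for a y
    using m0[OF that(1)] that by (simp add: m_def is_wmeet_def)
  have m: "m \<in> Obj E"
  proof (rule mem_vexp_if_hom_mono[OF Y(1)])
    fix a a' y assume "a \<in> Obj (vop A)" "a' \<in> Obj (vop A)" and y: "y \<in> Obj Y"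
    then have a: "a \<in> Obj A" "a' \<in> Obj A" by simp_all
    have "Hom Y y (m a) * Hom A a' a * \<nu> \<mu> \<le> Hom Y y (\<mu> a')" if \<mu>: "\<mu> \<in> Obj M" for \<mu>
    proof -
      have "Hom Y y (m a) * \<nu> \<mu> \<le> Hom Y y (\<mu> a)"
        using order_refl[of "Hom Y y (m a)"] \<mu>
        unfolding hom_m_at[OF a(1) y] le_INF_iff le_qimp_iff by blast
      moreover have "Hom A a' a \<le> Hom Y (\<mu> a) (\<mu> a')"
        using ME[OF \<mu>] a by (simp add: mem_vexp_iff)
      ultimately have "Hom Y y (m a) * \<nu> \<mu> * Hom A a' a \<le> Hom Y y (\<mu> a')"
        using hom_comp_le[OF Y(1) y E_at_in E_at_in] ME[OF \<mu>] a by blast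
      then show ?thesis by (simp add: ac_simps)
    qed
    then show "Hom Y y (m a) * Hom (vop A) a a' \<le> Hom Y y (m a')"
      by (simp add: hom_m_at[OF a(2) y] le_INF_iff le_qimp_iff)
  qed (use m_at in \<open>simp_all add: m_def\<close>)
  have hom_m: "Hom E \<kappa> m = (INF \<mu>\<in>Obj M. \<nu> \<mu> \<rightarrow>\<^sub>q Hom E \<kappa> \<mu>)" if \<kappa>: "\<kappa> \<in> Obj E" for \<kappa>
  proof (rule eq_if_same_lower_bounds)
    fix v
    show "v \<le> Hom E \<kappa> m \<longleftrightarrow> v \<le> (INF \<mu>\<in>Obj M. \<nu> \<mu> \<rightarrow>\<^sub>q Hom E \<kappa> \<mu>)"
      using E_at_in[OF \<kappa>] by (auto simp: Hom_vexp hom_m_at le_INF_iff le_qimp_iff)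
  qed
  \<comment> \<open>Homs from \<open>m\<close> and from its reflection into fixed points agree, so the identity of \<open>m\<close>
    extends to the reflection.\<close>
  have "Hom E (down (up m)) m = Hom E m m"
    using m by (auto simp: hom_m down_in up_in hom_down_up_left intro!: INF_cong)
  then have "m \<in> Obj M" using m hom_refl[OF E m] by (simp add: mem_M_if_le)
  then show "\<exists>m. is_wmeet M (Obj M) \<nu> (\<lambda>y. y) m"
    using hom_m ME by (auto simp: is_wmeet_def Hom_M)
qed

text \<open>The dense and the codense functor into \<open>M\<close>. Up to isomorphism, \<open>col a y\<close> is \<open>up\<close> of the
  representable functor at \<open>a\<close> tensored with \<open>y\<close>; describing it through \<open>\<phi>\<close> avoids tensors in \<open>Y\<close>.
  Dually, \<open>row b x\<close> is \<open>down\<close> of the representable functor at \<open>b\<close> tensored with \<open>x\<close>.\<close>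

definition col :: "'a \<Rightarrow> 'y \<Rightarrow> 'b \<Rightarrow> 'x" where
  "col a y = (\<lambda>b\<in>Obj B. limp (\<phi> (a, b), y))"

definition row :: "'b \<Rightarrow> 'x \<Rightarrow> 'a \<Rightarrow> 'y" where
  "row b x = (\<lambda>a\<in>Obj A. rimp (x, \<phi> (a, b)))"

lemma col_in:
  assumes "a \<in> Obj A" "y \<in> Obj Y"
  shows "col a y \<in> Obj G"
  using assms rel_mono_B
  by (intro mem_vexp_if_hom_mono[OF X(1)]) (auto simp: col_def hom_limp_\<phi> limp_in \<phi>_in)

lemma row_in:
  assumes "b \<in> Obj B" "x \<in> Obj X"
  shows "row b x \<in> Obj E"
  using assms rel_mono_A
  by (intro mem_vexp_if_hom_mono[OF Y(1)]) (auto simp: row_def hom_rimp_\<phi> rimp_in \<phi>_in)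

lemma hom_col:
  assumes "\<nu> \<in> Obj G" "a \<in> Obj A" "y \<in> Obj Y"
  shows "Hom G \<nu> (col a y) = Hom Y y (down \<nu> a)"
  using assms by (simp add: Hom_vexp col_def hom_limp_\<phi> G_at_in hom_down cong: INF_cong_simp)

lemma hom_row:
  assumes "\<mu> \<in> Obj E" "b \<in> Obj B" "x \<in> Obj X"
  shows "Hom E \<mu> (row b x) = Hom X x (up \<mu> b)"
  using assms by (simp add: Hom_vexp row_def hom_rimp_\<phi> E_at_in hom_up cong: INF_cong_simp)

lemma viso_at:
  assumes "viso (vexp W C) f g" "x \<in> Obj C"
  shows "viso W (f x) (g x)"
  using assms by (auto simp: viso_def vle_def Hom_vexp le_INF_iff)

text \<open>Homs into \<open>row b x\<close> depend only on the image under \<open>up\<close>, which does not change when the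
  closure is formed. So the identity of \<open>row b x\<close> extends to its closure.\<close>

lemma row_in_M:
  assumes "b \<in> Obj B" "x \<in> Obj X"
  shows "row b x \<in> Obj M"
proof (rule mem_M_if_le[OF row_in[OF assms]])
  note row = row_in[OF assms]
  have "Hom E (down (up (row b x))) (row b x) = Hom X x (up (down (up (row b x))) b)"
    by (intro hom_row down_in up_in row assms)
  also have "\<dots> = Hom X x (up (row b x) b)"
    by (intro viso_hom_right[OF X(1) _ _ _ viso_at[OF up_down_up]] up_at_in down_in up_in row assms)
  also have "\<dots> = Hom E (row b x) (row b x)"
    by (intro hom_row[symmetric] row assms)
  finally show "1 \<le> Hom E (down (up (row b x))) (row b x)"
    using hom_refl[OF E row] by simp
qed

lemma col_closed:
  assumes "a \<in> Obj A" "y \<in> Obj Y"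
  shows "viso G (up (down (col a y))) (col a y)"
proof -
  note col = col_in[OF assms]
  have "Hom G (up (down (col a y))) (col a y) = Hom Y y (down (up (down (col a y))) a)"
    by (intro hom_col down_in up_in col assms)
  also have "\<dots> = Hom Y y (down (col a y) a)"
    by (intro viso_hom_right[OF Y(1) _ _ _ viso_at[OF down_up_down]] down_at_in down_in up_in col)
       (simp_all add: assms)
  also have "\<dots> = Hom G (col a y) (col a y)"
    by (intro hom_col[symmetric] col assms)
  finally have "1 \<le> Hom G (up (down (col a y))) (col a y)"
    using hom_refl[OF G col] by simp
  moreover have "1 \<le> Hom G (col a y) (up (down (col a y)))"
    using hom_refl[OF E down_in[OF col]] by (simp add: hom_down_up col down_in)
  ultimately show ?thesis by (simp add: viso_def vle_def)
qed

text \<open>So \<open>down (col a y)\<close> is the reflection into \<open>M\<close> of the representable at \<open>a\<close> tensored with \<open>y\<close>.\<close>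

lemma hom_down_col:
  assumes \<mu>: "\<mu> \<in> Obj M" and "a \<in> Obj A" "y \<in> Obj Y"
  shows "Hom E (down (col a y)) \<mu> = Hom Y y (\<mu> a)"
proof -
  note col = col_in[OF assms(2,3)]
  from \<mu> have \<mu>E: "\<mu> \<in> Obj E" and iso: "viso E (down (up \<mu>)) \<mu>" by (simp_all add: mem_M_iff)
  have "Hom E (down (col a y)) \<mu> = Hom G (up \<mu>) (up (down (col a y)))"
    by (intro hom_to_M down_in col \<mu>)
  also have "\<dots> = Hom G (up \<mu>) (col a y)"
    by (intro viso_hom_right[OF G] up_in down_in col \<mu>E col_closed assms)
  also have "\<dots> = Hom Y y (down (up \<mu>) a)"
    by (intro hom_col up_in \<mu>E assms)
  also have "\<dots> = Hom Y y (\<mu> a)"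
    using \<mu>E assms
    by (intro viso_hom_right[OF Y(1) _ _ _ viso_at[OF iso]]) (simp_all add: down_at_in up_in E_at_in)
  finally show ?thesis .
qed

lemma hom_down_col_row:
  assumes "a \<in> Obj A" "b \<in> Obj B" "x \<in> Obj X" "y \<in> Obj Y"
  shows "Hom M (down (col a y)) (row b x) = rel a b x y"
  using assms by (simp add: Hom_M hom_down_col row_in_M) (simp add: row_def hom_rimp_\<phi>)

lemma vfunctor_down_col: "vfunctor (A \<otimes>\<^sub>V Y) M (\<lambda>(a, y). down (col a y))"
proof -
  have "Hom A a a' * Hom Y y y' \<le> Hom E (down (col a y)) (down (col a' y'))"
    if ob: "a \<in> Obj A" "a' \<in> Obj A" "y \<in> Obj Y" "y' \<in> Obj Y" for a a' y y'
  proof -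
    define \<mu> where "\<mu> = down (col a' y')"
    have \<mu>: "\<mu> \<in> Obj M" "\<mu> \<in> Obj E" using ob by (simp_all add: \<mu>_def down_in_M down_in col_in)
    have "1 \<le> Hom Y y' (\<mu> a')"
      using hom_refl[OF E \<mu>(2)] hom_down_col[OF \<mu>(1) ob(2,4)] by (simp add: \<mu>_def)
    moreover have "Hom A a a' \<le> Hom Y (\<mu> a') (\<mu> a)"
      using \<mu>(2) ob by (simp add: mem_vexp_iff)
    ultimately have "1 * Hom A a a' \<le> Hom Y y' (\<mu> a)"
      using hom_comp_le[OF Y(1) ob(4) E_at_in E_at_in] \<mu>(2) ob by blast
    then have "Hom Y y y' * Hom A a a' \<le> Hom Y y (\<mu> a)"
      using hom_comp_le[OF Y(1) ob(3,4) E_at_in order_refl] \<mu>(2) ob by simp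
    then show ?thesis
      unfolding \<mu>_def[symmetric] hom_down_col[OF \<mu>(1) ob(1,3)] by (simp add: mult.commute)
  qed
  then show ?thesis by (auto simp: vfunctor_def Hom_M down_in_M col_in)
qed

lemma vfunctor_row: "vfunctor (B \<otimes>\<^sub>V vop X) M (\<lambda>(b, x). row b x)"
proof -
  have "Hom B b b' * Hom X x' x \<le> Hom E (row b x) (row b' x')"
    if ob: "b \<in> Obj B" "b' \<in> Obj B" "x \<in> Obj X" "x' \<in> Obj X" for b b' x x'
  proof -
    define \<nu> where "\<nu> = up (row b x)"
    have \<nu>: "\<nu> \<in> Obj G" using ob by (simp add: \<nu>_def up_in row_in)
    have "1 \<le> Hom X x (\<nu> b)"
      using hom_refl[OF E row_in] hom_row[OF row_in] ob by (simp add: \<nu>_def)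
    moreover have "Hom B b b' \<le> Hom X (\<nu> b) (\<nu> b')"
      using \<nu> ob by (simp add: mem_vexp_iff)
    ultimately have "1 * Hom B b b' \<le> Hom X x (\<nu> b')"
      using hom_comp_le[OF X(1) ob(3) G_at_in G_at_in] \<nu> ob by blast
    then have "Hom X x' x * Hom B b b' \<le> Hom X x' (\<nu> b')"
      using hom_comp_le[OF X(1) ob(4,3) G_at_in order_refl] \<nu> ob by simp
    then show ?thesis
      using ob by (simp add: hom_row row_in \<nu>_def mult.commute)
  qed
  then show ?thesis by (auto simp: vfunctor_def Hom_M row_in_M)
qed

lemma vdense_down_col: "vdense (A \<otimes>\<^sub>V Y) M (\<lambda>(a, y). down (col a y))"
  unfolding vdense_iff[OF vcategory_M vfunctor_down_col]
proof (intro ballI)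
  fix \<mu> \<mu>' assume \<mu>: "\<mu> \<in> Obj M" "\<mu>' \<in> Obj M"
  then have "Hom M \<mu> \<mu>' = (INF (a, y)\<in>Obj A \<times> Obj Y. Hom Y y (\<mu> a) \<rightarrow>\<^sub>q Hom Y y (\<mu>' a))"
    by (simp add: Hom_M mem_M_iff hom_E_yoneda)
  also have "\<dots> = (INF p\<in>Obj (A \<otimes>\<^sub>V Y). Hom M (case p of (a, y) \<Rightarrow> down (col a y)) \<mu> \<rightarrow>\<^sub>q
      Hom M (case p of (a, y) \<Rightarrow> down (col a y)) \<mu>')"
    by (rule INF_cong) (auto simp: Hom_M hom_down_col \<mu>)
  finally show "Hom M \<mu> \<mu>' = \<dots>" .
qed

lemma vcodense_row: "vcodense (B \<otimes>\<^sub>V vop X) M (\<lambda>(b, x). row b x)"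
  unfolding vcodense_iff[OF vcategory_M vfunctor_row]
proof (intro ballI)
  fix \<mu> \<mu>' assume \<mu>: "\<mu> \<in> Obj M" "\<mu>' \<in> Obj M"
  then have \<mu>E: "\<mu> \<in> Obj E" "\<mu>' \<in> Obj E" by (simp_all add: mem_M_iff)
  have "Hom M \<mu>' \<mu> = Hom G (up \<mu>) (up \<mu>')"
    using hom_to_M[OF \<mu>E(2) \<mu>(1)] by (simp add: Hom_M)
  also have "\<dots> = (INF (b, x)\<in>Obj B \<times> Obj X. Hom X x (up \<mu> b) \<rightarrow>\<^sub>q Hom X x (up \<mu>' b))"
    by (intro hom_G_yoneda up_in \<mu>E)
  also have "\<dots> = (INF q\<in>Obj (B \<otimes>\<^sub>V vop X). Hom M \<mu> (case q of (b, x) \<Rightarrow> row b x) \<rightarrow>\<^sub>q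
      Hom M \<mu>' (case q of (b, x) \<Rightarrow> row b x))"
    by (rule INF_cong) (auto simp: Hom_M hom_row \<mu>E)
  finally show "Hom M \<mu>' \<mu> = \<dots>" .
qed

end

section \<open>Categories generated by a dense and a codense functor\<close>

locale isbell_generated = isbell X Y Z A B ten limp rimp \<phi>
  for X :: "('x, 'v::comm_quantale) vcat" and Y :: "('y, 'v) vcat" and Z :: "('z, 'v) vcat"
    and A :: "('a, 'v) vcat" and B :: "('b, 'v) vcat"
    and ten :: "'x \<times> 'y \<Rightarrow> 'z" and limp :: "'z \<times> 'y \<Rightarrow> 'x" and rimp :: "'x \<times> 'z \<Rightarrow> 'y"
    and \<phi> :: "'a \<times> 'b \<Rightarrow> 'z" +
  fixes C :: "('c, 'v) vcat" and \<alpha> :: "'a \<times> 'y \<Rightarrow> 'c" and \<beta> :: "'b \<times> 'x \<Rightarrow> 'c"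
  assumes C: "vcategory C" "vcomplete C"
    and \<alpha>: "vfunctor (A \<otimes>\<^sub>V Y) C \<alpha>" and dense: "vdense (A \<otimes>\<^sub>V Y) C \<alpha>"
    and \<beta>: "vfunctor (B \<otimes>\<^sub>V vop X) C \<beta>" and codense: "vcodense (B \<otimes>\<^sub>V vop X) C \<beta>"
    and hom_\<alpha>_\<beta>: "\<lbrakk>a \<in> Obj A; b \<in> Obj B; x \<in> Obj X; y \<in> Obj Y\<rbrakk> \<Longrightarrow>
      Hom C (\<alpha> (a, y)) (\<beta> (b, x)) = rel a b x y"
begin

lemma \<alpha>_in: "a \<in> Obj A \<Longrightarrow> y \<in> Obj Y \<Longrightarrow> \<alpha> (a, y) \<in> Obj C"
  and \<beta>_in: "b \<in> Obj B \<Longrightarrow> x \<in> Obj X \<Longrightarrow> \<beta> (b, x) \<in> Obj C"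
  using \<alpha> \<beta> by (auto simp: vfunctor_def)

lemma hom_dense:
  assumes "c \<in> Obj C" "c' \<in> Obj C"
  shows "Hom C c c' = (INF (a, y)\<in>Obj A \<times> Obj Y. Hom C (\<alpha> (a, y)) c \<rightarrow>\<^sub>q Hom C (\<alpha> (a, y)) c')"
proof -
  have "Hom C c c' = (INF p\<in>Obj A \<times> Obj Y. Hom C (\<alpha> p) c \<rightarrow>\<^sub>q Hom C (\<alpha> p) c')"
    using dense assms unfolding vdense_iff[OF C(1) \<alpha>] by simp
  also have "\<dots> = (INF (a, y)\<in>Obj A \<times> Obj Y. Hom C (\<alpha> (a, y)) c \<rightarrow>\<^sub>q Hom C (\<alpha> (a, y)) c')"
    by (rule INF_cong) auto
  finally show ?thesis .
qed

lemma hom_codense: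
  assumes "c \<in> Obj C" "c' \<in> Obj C"
  shows "Hom C c' c = (INF (b, x)\<in>Obj B \<times> Obj X. Hom C c (\<beta> (b, x)) \<rightarrow>\<^sub>q Hom C c' (\<beta> (b, x)))"
proof -
  have "Hom C c' c = (INF q\<in>Obj B \<times> Obj X. Hom C c (\<beta> q) \<rightarrow>\<^sub>q Hom C c' (\<beta> q))"
    using codense assms unfolding vcodense_iff[OF C(1) \<beta>] by simp
  also have "\<dots> = (INF (b, x)\<in>Obj B \<times> Obj X. Hom C c (\<beta> (b, x)) \<rightarrow>\<^sub>q Hom C c' (\<beta> (b, x)))"
    by (rule INF_cong) auto
  finally show ?thesis .
qed

lemma hom_\<alpha>_left:
  assumes "a \<in> Obj A" "y \<in> Obj Y" "c \<in> Obj C"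
  shows "Hom C (\<alpha> (a, y)) c = (INF (b, x)\<in>Obj B \<times> Obj X. Hom C c (\<beta> (b, x)) \<rightarrow>\<^sub>q rel a b x y)"
  unfolding hom_codense[OF assms(3) \<alpha>_in[OF assms(1,2)]]
  by (rule INF_cong) (auto simp: hom_\<alpha>_\<beta> assms)

lemma hom_\<beta>_right:
  assumes "b \<in> Obj B" "x \<in> Obj X" "c \<in> Obj C"
  shows "Hom C c (\<beta> (b, x)) = (INF (a, y)\<in>Obj A \<times> Obj Y. Hom C (\<alpha> (a, y)) c \<rightarrow>\<^sub>q rel a b x y)"
  unfolding hom_dense[OF assms(3) \<beta>_in[OF assms(1,2)]]
  by (rule INF_cong) (auto simp: hom_\<alpha>_\<beta> assms)

text \<open>Each functor \<open>\<alpha> (a, _)\<close> has a right adjoint: on the objects \<open>\<beta> (b, x)\<close> it takes the value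
  \<open>rimp (x, \<phi> (a, b))\<close>, and by codensity every object is a weighted meet of these.\<close>

lemma \<alpha>_right_adjoint:
  assumes a: "a \<in> Obj A" and c: "c \<in> Obj C"
  shows "\<exists>u\<in>Obj Y. \<forall>y\<in>Obj Y. Hom Y y u = Hom C (\<alpha> (a, y)) c"
proof -
  have "\<exists>u. is_wmeet Y (Obj B \<times> Obj X) (\<lambda>(b, x). Hom C c (\<beta> (b, x))) (\<lambda>(b, x). rimp (x, \<phi> (a, b))) u"
    using Y a by (intro ex_wmeet) (auto intro: rimp_in \<phi>_in)
  then obtain u where u: "u \<in> Obj Y"
    and hom_u: "\<And>y. y \<in> Obj Y \<Longrightarrow> Hom Y y u =
      (INF q\<in>Obj B \<times> Obj X. (case q of (b, x) \<Rightarrow> Hom C c (\<beta> (b, x))) \<rightarrow>\<^sub>q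
        Hom Y y (case q of (b, x) \<Rightarrow> rimp (x, \<phi> (a, b))))"
    unfolding is_wmeet_def by blast
  have "Hom Y y u = Hom C (\<alpha> (a, y)) c" if y: "y \<in> Obj Y" for y
    unfolding hom_u[OF y] hom_\<alpha>_left[OF a y c]
    by (rule INF_cong) (auto simp: hom_rimp_\<phi> a y)
  with u show ?thesis by blast
qed

text \<open>The values are representing objects, which are unique only up to isomorphism.\<close>

definition nerve :: "'c \<Rightarrow> 'a \<Rightarrow> 'y" where
  "nerve c = (\<lambda>a\<in>Obj A. SOME u. u \<in> Obj Y \<and> (\<forall>y\<in>Obj Y. Hom Y y u = Hom C (\<alpha> (a, y)) c))"

lemma
  assumes a: "a \<in> Obj A" and c: "c \<in> Obj C"
  shows nerve_at_in: "nerve c a \<in> Obj Y"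
    and hom_nerve_at: "y \<in> Obj Y \<Longrightarrow> Hom Y y (nerve c a) = Hom C (\<alpha> (a, y)) c"
proof -
  have "\<exists>u. u \<in> Obj Y \<and> (\<forall>y\<in>Obj Y. Hom Y y u = Hom C (\<alpha> (a, y)) c)"
    using \<alpha>_right_adjoint[OF assms] by blast
  from someI_ex[OF this]
  have "nerve c a \<in> Obj Y \<and> (\<forall>y\<in>Obj Y. Hom Y y (nerve c a) = Hom C (\<alpha> (a, y)) c)"
    using a by (simp add: nerve_def)
  then show "nerve c a \<in> Obj Y" and "y \<in> Obj Y \<Longrightarrow> Hom Y y (nerve c a) = Hom C (\<alpha> (a, y)) c"
    by blast+
qed

lemma nerve_in:
  assumes c: "c \<in> Obj C"
  shows "nerve c \<in> Obj E"
proof (rule mem_vexp_if_hom_mono[OF Y(1)])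
  fix a a' y assume "a \<in> Obj (vop A)" "a' \<in> Obj (vop A)" and y: "y \<in> Obj Y"
  then have a: "a \<in> Obj A" "a' \<in> Obj A" by simp_all
  have "Hom A a' a * 1 \<le> Hom A a' a * Hom Y y y"
    by (intro mult_mono_q hom_refl Y y)
  also have "\<dots> = Hom (A \<otimes>\<^sub>V Y) (a', y) (a, y)" by simp
  also have "\<dots> \<le> Hom C (\<alpha> (a', y)) (\<alpha> (a, y))"
    using \<alpha> a y unfolding vfunctor_def by (simp del: Hom_vtensor)
  finally have "Hom A a' a * Hom C (\<alpha> (a, y)) c \<le> Hom C (\<alpha> (a', y)) c"
    by (intro hom_comp_le[OF C(1) \<alpha>_in[OF a(2) y] \<alpha>_in[OF a(1) y] c]) simp_all
  then show "Hom Y y (nerve c a) * Hom (vop A) a a' \<le> Hom Y y (nerve c a')"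
    using a y c by (simp add: hom_nerve_at mult.commute)
qed (use nerve_at_in[OF _ c] in \<open>auto simp: nerve_def\<close>)

lemma hom_nerve:
  assumes "c \<in> Obj C" "c' \<in> Obj C"
  shows "Hom E (nerve c) (nerve c') = Hom C c c'"
  unfolding hom_E_yoneda[OF nerve_in nerve_in, OF assms] hom_dense[OF assms]
  by (rule INF_cong) (auto simp: hom_nerve_at assms)

text \<open>By codensity an object \<open>c\<close> is known from its homs into the objects \<open>\<beta> (b, x)\<close>. If these are
  represented by \<open>up \<mu>\<close>, then \<open>hom_\<alpha>_left\<close> and \<open>hom_down_yoneda\<close> give the same meet.\<close>

lemma viso_nerve_down_up:
  assumes \<mu>: "\<mu> \<in> Obj E" and c: "c \<in> Obj C"
    and eq: "\<And>b x. b \<in> Obj B \<Longrightarrow> x \<in> Obj X \<Longrightarrow> Hom C c (\<beta> (b, x)) = Hom X x (up \<mu> b)"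
  shows "viso E (nerve c) (down (up \<mu>))"
proof (rule viso_vexpI[OF Y(1) nerve_in[OF c] down_in[OF up_in[OF \<mu>]]])
  fix a y assume "a \<in> Obj (vop A)" and y: "y \<in> Obj Y"
  then have a: "a \<in> Obj A" by simp
  show "Hom Y y (nerve c a) = Hom Y y (down (up \<mu>) a)"
    unfolding hom_nerve_at[OF a c y] hom_\<alpha>_left[OF a y c] hom_down_yoneda[OF up_in[OF \<mu>] a y]
    by (rule INF_cong) (auto simp: eq)
qed

lemma nerve_in_M:
  assumes c: "c \<in> Obj C"
  shows "nerve c \<in> Obj M"
proof -
  have "Hom C c (\<beta> (b, x)) = Hom X x (up (nerve c) b)" if b: "b \<in> Obj B" and x: "x \<in> Obj X" for b x
    unfolding hom_\<beta>_right[OF b x c] hom_up_yoneda[OF nerve_in[OF c] b x]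
    by (rule INF_cong) (auto simp: hom_nerve_at c)
  from viso_nerve_down_up[OF nerve_in[OF c] c this]
  show ?thesis by (simp add: mem_M_iff nerve_in[OF c] viso_sym)
qed

text \<open>A fixed point \<open>\<mu>\<close> is the nerve of the join of the objects \<open>\<alpha> (a, y)\<close> with the
  weights \<open>Hom Y y (\<mu> a)\<close>.\<close>

lemma nerve_essentially_surjective:
  assumes "\<mu> \<in> Obj M"
  shows "\<exists>c\<in>Obj C. viso M (nerve c) \<mu>"
proof -
  from assms have \<mu>: "\<mu> \<in> Obj E" and iso: "viso E (down (up \<mu>)) \<mu>" by (simp_all add: mem_M_iff)
  have "\<exists>c. is_wmeet (vop C) (Obj A \<times> Obj Y) (\<lambda>(a, y). Hom Y y (\<mu> a)) \<alpha> c"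
    using C by (intro ex_wmeet vcomplete_vop) (auto intro: \<alpha>_in)
  then obtain c where c: "c \<in> Obj C" and hom_c: "\<And>d. d \<in> Obj C \<Longrightarrow> Hom C c d =
      (INF p\<in>Obj A \<times> Obj Y. (case p of (a, y) \<Rightarrow> Hom Y y (\<mu> a)) \<rightarrow>\<^sub>q Hom C (\<alpha> p) d)"
    unfolding is_wmeet_def by auto
  have "Hom C c (\<beta> (b, x)) = Hom X x (up \<mu> b)" if b: "b \<in> Obj B" and x: "x \<in> Obj X" for b x
    unfolding hom_c[OF \<beta>_in[OF b x]] hom_up_yoneda[OF \<mu> b x]
    by (rule INF_cong) (auto simp: hom_\<alpha>_\<beta> b x)
  then have "viso E (nerve c) (down (up \<mu>))" by (rule viso_nerve_down_up[OF \<mu> c])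
  then have "viso E (nerve c) \<mu>"
    using viso_hom_right[OF E _ _ nerve_in[OF c] iso] viso_hom_left[OF E _ _ nerve_in[OF c] iso]
      \<mu> up_in down_in by (simp add: viso_def vle_def)
  then show ?thesis using c by (auto simp: viso_M)
qed

lemma vequivalent_M: "vequivalent C M"
proof (rule vequivalentI[OF C(1) vcategory_M, where f = nerve])
  show "Hom M (nerve c) (nerve c') = Hom C c c'" if "c \<in> Obj C" "c' \<in> Obj C" for c c'
    using hom_nerve[OF that] by (simp add: Hom_M)
qed (fact nerve_in_M nerve_essentially_surjective)+

end

section \<open>The representation theorem\<close>

theorem theorem6p2:
  fixes X :: "('x, 'v::comm_quantale) vcat" and Y :: "('y, 'v) vcat" and Z :: "('z, 'v) vcat"
    and A :: "('a, 'v) vcat" and B :: "('b, 'v) vcat" and C :: "('c, 'v) vcat"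
    and ten :: "'x \<times> 'y \<Rightarrow> 'z" and limp :: "'z \<times> 'y \<Rightarrow> 'x" and rimp :: "'x \<times> 'z \<Rightarrow> 'y"
    and \<phi> :: "'a \<times> 'b \<Rightarrow> 'z"
  assumes "vcategory X" and "vcomplete X"
    and "vcategory Y" and "vcomplete Y"
    and "vcategory Z" and "vcomplete Z"
    and "two_var_adjunction X Y Z ten limp rimp"
    and "vcategory A" and "vcategory B"
    and "vfunctor (vop A \<otimes>\<^sub>V B) Z \<phi>"
    and "vcategory C"
  shows "vequivalent C (Mphi X Y limp rimp A B \<phi>) \<longleftrightarrow>
    vcomplete C \<and>
    (\<exists>\<alpha> \<beta>.
       vfunctor (A \<otimes>\<^sub>V Y) C \<alpha> \<and> vdense (A \<otimes>\<^sub>V Y) C \<alpha> \<and>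
       vfunctor (B \<otimes>\<^sub>V vop X) C \<beta> \<and> vcodense (B \<otimes>\<^sub>V vop X) C \<beta> \<and>
       (\<forall>a\<in>Obj A. \<forall>b\<in>Obj B. \<forall>x\<in>Obj X. \<forall>y\<in>Obj Y.
          Hom C (\<alpha> (a, y)) (\<beta> (b, x)) = Hom Z (ten (x, y)) (\<phi> (a, b))))"
proof -
  interpret isbell X Y Z A B ten limp rimp \<phi>
    by unfold_locales (rule assms)+
  show ?thesis
  proof
    assume eq: "vequivalent C M"
    note C = \<open>vcategory C\<close>
    obtain f g where f: "vfunctor C M f" and g: "vfunctor M C g"
      and gf: "\<forall>c\<in>Obj C. viso C (g (f c)) c" and fg: "\<forall>\<mu>\<in>Obj M. viso M (f (g \<mu>)) \<mu>"
      using eq unfolding vequivalent_def by blast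
    \<comment> \<open>Carry the two generating functors of \<open>M\<close> over to \<open>C\<close>.\<close>
    let ?\<alpha> = "g \<circ> (\<lambda>(a, y). down (col a y))" and ?\<beta> = "g \<circ> (\<lambda>(b, x). row b x)"
    have "vdense (A \<otimes>\<^sub>V Y) C ?\<alpha>"
      by (rule vdense_equivalence[OF C vcategory_M f g gf fg vfunctor_down_col vdense_down_col])
    moreover have "vcodense (B \<otimes>\<^sub>V vop X) C ?\<beta>"
      unfolding vcodense_eq_vdense_vop
      \<comment> \<open>An equivalence is also one between the opposite categories.\<close>
      using vdense_equivalence[of "vop C" "vop M" f g "vop (B \<otimes>\<^sub>V vop X)" "\<lambda>(b, x). row b x"]
        C vcategory_M f g gf fg vfunctor_row vcodense_row
      by (simp add: vcodense_eq_vdense_vop viso_def vle_def conj_commute)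
    moreover have "Hom C (?\<alpha> (a, y)) (?\<beta> (b, x)) = Hom Z (ten (x, y)) (\<phi> (a, b))"
      if ob: "a \<in> Obj A" "b \<in> Obj B" "x \<in> Obj X" "y \<in> Obj Y" for a b x y
    proof -
      have M: "down (col a y) \<in> Obj M" "row b x \<in> Obj M"
        using ob by (simp_all add: down_in_M col_in row_in_M)
      then have fgr: "f (g (row b x)) \<in> Obj M" "g (row b x) \<in> Obj C"
        using f g by (auto simp: vfunctor_def)
      have "Hom C (g (down (col a y))) (g (row b x)) = Hom M (down (col a y)) (f (g (row b x)))"
        using hom_equivalence[OF C vcategory_M f g gf fg fgr(2) M(1)] by simp
      also have "\<dots> = Hom M (down (col a y)) (row b x)"
        using viso_hom_right[OF vcategory_M fgr(1) M(2,1)] fg M by blast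
      also have "\<dots> = Hom Z (ten (x, y)) (\<phi> (a, b))"
        using ob by (rule hom_down_col_row)
      finally show ?thesis by simp
    qed
    ultimately show "vcomplete C \<and> (\<exists>\<alpha> \<beta>.
       vfunctor (A \<otimes>\<^sub>V Y) C \<alpha> \<and> vdense (A \<otimes>\<^sub>V Y) C \<alpha> \<and>
       vfunctor (B \<otimes>\<^sub>V vop X) C \<beta> \<and> vcodense (B \<otimes>\<^sub>V vop X) C \<beta> \<and>
       (\<forall>a\<in>Obj A. \<forall>b\<in>Obj B. \<forall>x\<in>Obj X. \<forall>y\<in>Obj Y.
          Hom C (\<alpha> (a, y)) (\<beta> (b, x)) = Hom Z (ten (x, y)) (\<phi> (a, b))))"
      using vequivalent_complete[OF C vcategory_M complete_M eq]
        vfunctor_comp[OF vfunctor_down_col g] vfunctor_comp[OF vfunctor_row g] by blast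
  next
    assume "vcomplete C \<and> (\<exists>\<alpha> \<beta>.
       vfunctor (A \<otimes>\<^sub>V Y) C \<alpha> \<and> vdense (A \<otimes>\<^sub>V Y) C \<alpha> \<and>
       vfunctor (B \<otimes>\<^sub>V vop X) C \<beta> \<and> vcodense (B \<otimes>\<^sub>V vop X) C \<beta> \<and>
       (\<forall>a\<in>Obj A. \<forall>b\<in>Obj B. \<forall>x\<in>Obj X. \<forall>y\<in>Obj Y.
          Hom C (\<alpha> (a, y)) (\<beta> (b, x)) = Hom Z (ten (x, y)) (\<phi> (a, b))))"
    then obtain \<alpha> \<beta> where
      "vcomplete C" "vfunctor (A \<otimes>\<^sub>V Y) C \<alpha>" "vdense (A \<otimes>\<^sub>V Y) C \<alpha>"
      "vfunctor (B \<otimes>\<^sub>V vop X) C \<beta>" "vcodense (B \<otimes>\<^sub>V vop X) C \<beta>"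
      "\<forall>a\<in>Obj A. \<forall>b\<in>Obj B. \<forall>x\<in>Obj X. \<forall>y\<in>Obj Y.
          Hom C (\<alpha> (a, y)) (\<beta> (b, x)) = Hom Z (ten (x, y)) (\<phi> (a, b))"
      by blast
    then interpret isbell_generated X Y Z A B ten limp rimp \<phi> C \<alpha> \<beta>
      using \<open>vcategory C\<close> by unfold_locales auto
    show "vequivalent C M" by (rule vequivalent_M)
  qed
qed

end
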